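(* Let $n\ge 1$, let $K$ be a finite simplicial complex, $\mathcal{K}=\{K^u\}_{u\in\mathbb{R}^n}$ a tame and one-critical filtration of $K$, $\mathcal{V}$ a discrete gradient vector field on $K$ consistent with $\mathcal{K}$, $C$ the set of entrance values of critical simplices of $\mathcal{V}$, and $\overline{C}$ its closure under least upper bound. Let $\mathbb{V}$ be the persistence module $u\mapsto H_k(K^u;\mathbb{K})$ for a fixed field $\mathbb{K}$ and integer $k$. Let $L\sim_{\overline{C}}L'$ be equivalent lines with positive slope, parametrized by $L: u=\vec m s+u_0$ and $L': u=\vec m' s'+u'_0$ respectively (with $\vec m,\vec m'\succ 0$). Let $\mathrm{dgm}(\mathbb{V}_L)$ and $\mathrm{dgm}(\mathbb{V}_{L'})$ be the persistence diagrams of the restrictions of $\mathbb{V}$ to $L$ and $L'$. Then there exists a multi-bijection (a bijection between sets of points with multiplicities, i.e. a multiplicity-preserving bijection) $\gamma:\mathrm{dgm}(\mathbb{V}_L)\to\mathrm{dgm}(\mathbb{V}_{L'})$ such that, for all $(s,t)\in\mathrm{dgm}(\mathbb{V}_L)$, $\gamma(s,t)=(s',t')\in \mathrm{dgm}(\mathbb{V}_{L'})$ with - $s'\in\mathbb{R}$ such that $\vec m's'+u'_0=\mathrm{push}_{L'}\big(\overline{\vec m s+u_0}\big)$, and - $t'\in\mathbb{R}$ such that $\vec m't'+u'_0=\mathrm{push}_{L'}\big(\overline{\vec m t+u_0}\big)$ if $t\in\mathbb{R}$, while $t'=\infty$ if $t=\infty$.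
   Context: Order: for $u,v\in\mathbb{R}^n$, $u\preceq v$ means $u_j\le v_j$ for all $j$, and $u\prec v$ means $u_j<v_j$ for all $j$. Least upper bounds are coordinatewise maxima. A finite simplicial complex $K$ is a finite collection of non-empty finite sets (simplices) closed under taking non-empty subsets; $\alpha$ is a facet of $\beta$ if $\alpha\subset\beta$ has codimension one. A filtration of $K$ is a family of subcomplexes $\{K^u\}_{u\in\mathbb{R}^n}$ with $K^u\subseteq K^v$ whenever $u\preceq v$ and $K=\bigcup_u K^u$. It is tame and one-critical if every simplex $\sigma$ has a (unique) entrance value $e(\sigma)\in\mathbb{R}^n$, such that $\sigma\in K^v$ iff $e(\sigma)\preceq v$. A discrete vector field $\mathcal{V}$ on $K$ is a set of pairs $(\alpha,\beta)$ with $\alpha$ a facet of $\beta$, each simplex being in at most one pair. A $V$-path is a sequence $\alpha_0,\beta_0,\alpha_1,\dots,\beta_r,\alpha_{r+1}$ with $(\alpha_i,\beta_i)\in\mathcal{V}$ and $\alpha_{i+1}\neq\alpha_i$ a facet of $\beta_i$; it is non-trivial closed if $r>0$ and $\alpha_0=\alpha_{r+1}$. $\mathcal{V}$ is a gradient vector field if there is no non-trivial closed $V$-path. A simplex is critical if it is in no pair of $\mathcal{V}$. $\mathcal{V}$ is consistent with $\mathcal{K}$ if for all $(\sigma,\tau)\in\mathcal{V}$ and all $u$, $\sigma\in K^u\iff\tau\in K^u$. $\overline{C}$ is the set of least upper bounds of non-empty finite subsets of $C$. For $u\in\mathbb{R}^n$ with $\{u'\in\overline{C}\mid u'\preceq u\}\neq\varnothing$,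 $\overline{u}=\max\{u'\in\overline{C}\mid u'\preceq u\}$ (it exists). A line $L=\{\vec m t+u_0: t\in\mathbb{R}\}$ has positive slope if $\vec m\succ 0$. Let $S_+(u)=\{v: u\preceq v\}$. Its boundary is the disjoint union of the open faces $S_A(u)=\{x: x_i=u_i \text{ for } i\in A,\ x_j>u_j\text{ for }j\notin A\}$, $\varnothing\ne A\subseteq\{1,\dots,n\}$. For $L$ of positive slope, $\mathrm{push}_L(u)$ is the unique point of $L\cap\partial S_+(u)$. $L\sim_{\overline{C}}L'$ means that for every $u\in\overline{C}$, $\mathrm{push}_L(u)$ and $\mathrm{push}_{L'}(u)$ belong to the same open face of $\partial S_+(u)$. $\mathbb{V}_L$ is the 1-parameter persistence module $t\mapsto H_k(K^{\vec m t+u_0};\mathbb{K})$ with the maps induced by inclusions; $\mathbb{V}_{L'}$ is analogous. For a 1-parameter module $\mathbb{W}$ with rank function $\rho(s,t)=\operatorname{rank}(W_s\to W_t)$, $s\le t$, $\mathrm{dgm}(\mathbb{W})$ is the multiset of pairs $(s,t)$, $s<t\le\infty$, with positive multiplicity, where for $t<\infty$ $$\mu(s,t)=\min_{e>0,\ s+e<t-e}\rho(s+e,t-e)-\rho(s-e,t-e)-\rho(s+e,t+e)+\rho(s-e,t+e),$$ and $\mu(s,\infty)=\min_{e>0,\ t\ge s+e}\rho(s+e,t)-\rho(s-e,t)$. *)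

theory Defs
  imports
    "HOL-Analysis.Analysis"
    "HOL-Algebra.AbelCoset"
    "Jordan_Normal_Form.Missing_VectorSpace"
begin

section \<open>The order on \<open>\<real>\<^sup>n\<close> and lines of positive slope\<close>

text \<open>
  The library order \<open>\<le>\<close> on \<^typ>\<open>real ^ 'n\<close> is coordinatewise. The library \<open><\<close> is its strict
  part, not strict inequality in all coordinates; the latter is the following relation.
\<close>

definition strictly_below :: "real ^ 'n \<Rightarrow> real ^ 'n \<Rightarrow> bool" (infix \<open>\<prec>\<close> 50)
  where "u \<prec> v \<longleftrightarrow> (\<forall>i. u $ i < v $ i)"

definition lub_closure :: "(real ^ 'n) set \<Rightarrow> (real ^ 'n) set"
  where "lub_closure C = {Sup_fin F | F. finite F \<and> F \<noteq> {} \<and> F \<subseteq> C}"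

text \<open>\<open>lower_proj D u\<close> is meaningful only if \<open>D\<close> contains some element below \<open>u\<close>.\<close>

definition lower_proj :: "(real ^ 'n) set \<Rightarrow> real ^ 'n \<Rightarrow> real ^ 'n"
  where "lower_proj D u = (GREATEST u'. u' \<in> D \<and> u' \<le> u)"

definition line :: "real ^ 'n \<Rightarrow> real ^ 'n \<Rightarrow> (real ^ 'n) set"
  where "line m u0 = range (\<lambda>t. t *\<^sub>R m + u0)"

definition open_face :: "'n set \<Rightarrow> real ^ 'n \<Rightarrow> (real ^ 'n) set"
  where "open_face A u = {x. (\<forall>i\<in>A. x $ i = u $ i) \<and> (\<forall>j. j \<notin> A \<longrightarrow> u $ j < x $ j)}"

definition push :: "(real ^ 'n) set \<Rightarrow> real ^ 'n \<Rightarrow> real ^ 'n"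
  where "push L u = (THE x. x \<in> L \<inter> frontier {u..})"

definition line_equiv ::
    "(real ^ 'n) set \<Rightarrow> (real ^ 'n) set \<Rightarrow> (real ^ 'n) set \<Rightarrow> bool"
  where "line_equiv D L L' \<longleftrightarrow>
    (\<forall>u\<in>D. \<exists>A. A \<noteq> {} \<and> push L u \<in> open_face A u \<and> push L' u \<in> open_face A u)"


section \<open>Simplicial complexes, filtrations and discrete vector fields\<close>

definition finite_simplicial_complex :: "'v set set \<Rightarrow> bool"
  where "finite_simplicial_complex K \<longleftrightarrow>
    finite K \<and> (\<forall>\<sigma>\<in>K. finite \<sigma> \<and> \<sigma> \<noteq> {}) \<and>
    (\<forall>\<sigma>\<in>K. \<forall>\<tau>. \<tau> \<noteq> {} \<and> \<tau> \<subseteq> \<sigma> \<longrightarrow> \<tau> \<in> K)"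

definition facet :: "'v set \<Rightarrow> 'v set \<Rightarrow> bool"
  where "facet \<alpha> \<beta> \<longleftrightarrow> \<alpha> \<subset> \<beta> \<and> card \<beta> = card \<alpha> + 1"

definition filtration :: "'v set set \<Rightarrow> (real ^ 'n \<Rightarrow> 'v set set) \<Rightarrow> bool"
  where "filtration K F \<longleftrightarrow>
    (\<forall>u. finite_simplicial_complex (F u) \<and> F u \<subseteq> K) \<and>
    (\<forall>u v. u \<le> v \<longrightarrow> F u \<subseteq> F v) \<and> K = (\<Union>u. F u)"

definition tame_one_critical :: "'v set set \<Rightarrow> (real ^ 'n \<Rightarrow> 'v set set) \<Rightarrow> bool"
  where "tame_one_critical K F \<longleftrightarrow> (\<forall>\<sigma>\<in>K. \<exists>!e. \<forall>v. \<sigma> \<in> F v \<longleftrightarrow> e \<le> v)"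

definition entrance :: "(real ^ 'n \<Rightarrow> 'v set set) \<Rightarrow> 'v set \<Rightarrow> real ^ 'n"
  where "entrance F \<sigma> = (THE e. \<forall>v. \<sigma> \<in> F v \<longleftrightarrow> e \<le> v)"

definition discrete_vector_field :: "'v set set \<Rightarrow> ('v set \<times> 'v set) set \<Rightarrow> bool"
  where "discrete_vector_field K V \<longleftrightarrow>
    (\<forall>(\<alpha>, \<beta>)\<in>V. \<alpha> \<in> K \<and> \<beta> \<in> K \<and> facet \<alpha> \<beta>) \<and>
    (\<forall>p\<in>V. \<forall>q\<in>V. p \<noteq> q \<longrightarrow> {fst p, snd p} \<inter> {fst q, snd q} = {})"

text \<open>
  \<open>V_path V r \<alpha> \<beta>\<close>: the sequence \<open>\<alpha> 0, \<beta> 0, \<alpha> 1, \<dots>, \<beta> r, \<alpha> (r + 1)\<close> is a V-path;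
  later values of \<open>\<alpha>\<close> and \<open>\<beta>\<close> are irrelevant.
\<close>

definition V_path ::
    "('v set \<times> 'v set) set \<Rightarrow> nat \<Rightarrow> (nat \<Rightarrow> 'v set) \<Rightarrow> (nat \<Rightarrow> 'v set) \<Rightarrow> bool"
  where "V_path V r \<alpha> \<beta> \<longleftrightarrow>
    (\<forall>i\<le>r. (\<alpha> i, \<beta> i) \<in> V \<and> \<alpha> (i + 1) \<noteq> \<alpha> i \<and> facet (\<alpha> (i + 1)) (\<beta> i))"

definition gradient_vector_field :: "'v set set \<Rightarrow> ('v set \<times> 'v set) set \<Rightarrow> bool"
  where "gradient_vector_field K V \<longleftrightarrow>
    discrete_vector_field K V \<and>
    \<not> (\<exists>r \<alpha> \<beta>. V_path V r \<alpha> \<beta> \<and> r > 0 \<and> \<alpha> 0 = \<alpha> (r + 1))"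

definition critical_simplices :: "'v set set \<Rightarrow> ('v set \<times> 'v set) set \<Rightarrow> 'v set set"
  where "critical_simplices K V = {\<sigma>\<in>K. \<forall>(\<alpha>, \<beta>)\<in>V. \<sigma> \<noteq> \<alpha> \<and> \<sigma> \<noteq> \<beta>}"

definition consistent_with ::
    "('v set \<times> 'v set) set \<Rightarrow> (real ^ 'n \<Rightarrow> 'v set set) \<Rightarrow> bool"
  where "consistent_with V F \<longleftrightarrow> (\<forall>(\<sigma>, \<tau>)\<in>V. \<forall>u. \<sigma> \<in> F u \<longleftrightarrow> \<tau> \<in> F u)"


section \<open>Simplicial homology with coefficients in a field\<close>

text \<open>
  The field is a type \<^typ>\<open>'k::field\<close>, turned into a ring record so that the vector spaces over
  it can be represented by \<open>module\<close> records. The \<open>mult\<close> and \<open>one\<close> fields of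
  those records carry no information.
\<close>

abbreviation coeff_field :: "'k::field ring"
  where "coeff_field \<equiv> \<lparr>carrier = UNIV, mult = (*), one = 1, zero = 0, add = (+)\<rparr>"

text \<open>
  A \<open>k\<close>-chain is its coefficient function on simplices. The degree \<open>k\<close> is an arbitrary integer;
  since simplices are non-empty there are no non-zero chains in negative degrees.
\<close>

definition chain_space :: "'v set set \<Rightarrow> int \<Rightarrow> ('k::field, 'v set \<Rightarrow> 'k) module"
  where "chain_space K k =
    \<lparr>carrier = {c. \<forall>\<sigma>. c \<sigma> \<noteq> 0 \<longrightarrow> \<sigma> \<in> K \<and> int (card \<sigma>) = k + 1},
     mult = (\<lambda>_ _ _. 0), one = (\<lambda>_. 0),
     zero = (\<lambda>_. 0), add = (\<lambda>c d \<sigma>. c \<sigma> + d \<sigma>),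
     smult = (\<lambda>a c \<sigma>. a * c \<sigma>)\<rparr>"

text \<open>
  A linear order \<open>r\<close> on the vertices orients every simplex by listing its vertices increasingly.
  If \<open>\<alpha>\<close> is obtained from \<open>\<beta> = [v\<^sub>0, \<dots>, v\<^sub>d]\<close> by deleting \<open>v\<^sub>i\<close>, then exactly
  \<open>i\<close> vertices of \<open>\<alpha>\<close> precede the deleted one, so the incidence number below is \<open>(-1)\<^sup>i\<close> and
  \<open>boundary\<close> is the linear extension of
  \<open>[v\<^sub>0, \<dots>, v\<^sub>d] \<mapsto> \<Sum>i. (-1)\<^sup>i [v\<^sub>0, \<dots>, v\<^sub>i\<^sub>-\<^sub>1, v\<^sub>i\<^sub>+\<^sub>1, \<dots>, v\<^sub>d]\<close>
  (vertices are sent to \<open>0\<close>, as the empty set is not a simplex).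
\<close>

definition incidence :: "'v rel \<Rightarrow> 'v set \<Rightarrow> 'v set \<Rightarrow> 'k::field"
  where "incidence r \<alpha> \<beta> = (- 1) ^ card {w\<in>\<alpha>. \<exists>v\<in>\<beta> - \<alpha>. (w, v) \<in> r}"

definition boundary :: "'v rel \<Rightarrow> 'v set set \<Rightarrow> ('v set \<Rightarrow> 'k::field) \<Rightarrow> 'v set \<Rightarrow> 'k"
  where "boundary r K c =
    (\<lambda>\<alpha>. if \<alpha> \<in> K then \<Sum>\<beta>\<in>{\<beta>\<in>K. facet \<alpha> \<beta>}. incidence r \<alpha> \<beta> * c \<beta> else 0)"

definition cycles :: "'v rel \<Rightarrow> 'v set set \<Rightarrow> int \<Rightarrow> ('v set \<Rightarrow> 'k::field) set"
  where "cycles r K k = {c \<in> carrier (chain_space K k). boundary r K c = (\<lambda>_. 0)}"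

definition boundaries :: "'v rel \<Rightarrow> 'v set set \<Rightarrow> int \<Rightarrow> ('v set \<Rightarrow> 'k::field) set"
  where "boundaries r K k = boundary r K ` carrier (chain_space K (k + 1))"

definition quotient_space :: "('k, 'a) module \<Rightarrow> 'a set \<Rightarrow> ('k, 'a set) module"
  where "quotient_space M B =
    \<lparr>carrier = a_rcosets\<^bsub>M\<^esub> B, mult = (\<lambda>_ _. B), one = B,
     zero = B, add = set_add M,
     smult = (\<lambda>a X. \<Union>x\<in>X. B +>\<^bsub>M\<^esub> (a \<odot>\<^bsub>M\<^esub> x))\<rparr>"

definition homology ::
    "'v rel \<Rightarrow> 'v set set \<Rightarrow> int \<Rightarrow> ('k::field, ('v set \<Rightarrow> 'k) set) module"
  where "homology r K k =
    quotient_space ((chain_space K k)\<lparr>carrier := cycles r K k\<rparr>) (boundaries r K k)"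

text \<open>
  The map in homology induced by an inclusion into \<open>L\<close>: the class of a cycle \<open>z\<close> goes to the
  class of \<open>z\<close> modulo the boundaries of \<open>L\<close>.
\<close>

definition inclusion_map ::
    "'v rel \<Rightarrow> 'v set set \<Rightarrow> int \<Rightarrow> ('v set \<Rightarrow> 'k::field) set \<Rightarrow> ('v set \<Rightarrow> 'k) set"
  where "inclusion_map r L k X = (\<Union>z\<in>X. boundaries r L k +>\<^bsub>chain_space L k\<^esub> z)"


section \<open>Persistence modules and their diagrams\<close>

text \<open>\<open>pm_map W s t\<close> is the structure map from index \<open>s\<close> to index \<open>t\<close>, meaningful for \<open>s \<le> t\<close>.\<close>

record ('i, 'k, 'a) pers_module =
  pm_space :: "'i \<Rightarrow> ('k, 'a) module"
  pm_map :: "'i \<Rightarrow> 'i \<Rightarrow> 'a \<Rightarrow> 'a"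

definition pers_homology ::
    "'v rel \<Rightarrow> (real ^ 'n \<Rightarrow> 'v set set) \<Rightarrow> int \<Rightarrow>
      (real ^ 'n, 'k::field, ('v set \<Rightarrow> 'k) set) pers_module"
  where "pers_homology r F k =
    \<lparr>pm_space = (\<lambda>u. homology r (F u) k), pm_map = (\<lambda>u v. inclusion_map r (F v) k)\<rparr>"

definition restrict_to_line ::
    "(real ^ 'n, 'k, 'a) pers_module \<Rightarrow> real ^ 'n \<Rightarrow> real ^ 'n \<Rightarrow> (real, 'k, 'a) pers_module"
  where "restrict_to_line W m u0 =
    \<lparr>pm_space = (\<lambda>t. pm_space W (t *\<^sub>R m + u0)),
     pm_map = (\<lambda>s t. pm_map W (s *\<^sub>R m + u0) (t *\<^sub>R m + u0))\<rparr>"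

definition rank_fun :: "(real, 'k::field, 'a) pers_module \<Rightarrow> real \<Rightarrow> real \<Rightarrow> int"
  where "rank_fun W s t = int (vectorspace.dim coeff_field
    ((pm_space W t)\<lparr>carrier := pm_map W s t ` carrier (pm_space W s)\<rparr>))"

definition multiplicity_fin :: "(real, 'k::field, 'a) pers_module \<Rightarrow> real \<Rightarrow> real \<Rightarrow> int"
  where "multiplicity_fin W s t = (LEAST n. \<exists>e>0. s + e < t - e \<and>
    n = rank_fun W (s + e) (t - e) - rank_fun W (s - e) (t - e)
      - rank_fun W (s + e) (t + e) + rank_fun W (s - e) (t + e))"

definition multiplicity_inf :: "(real, 'k::field, 'a) pers_module \<Rightarrow> real \<Rightarrow> int"
  where "multiplicity_inf W s = (LEAST n. \<exists>e>0. \<exists>t\<ge>s + e.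
    n = rank_fun W (s + e) t - rank_fun W (s - e) t)"

text \<open>
  Multisets whose support need not be finite are represented by their multiplicity functions;
  the points of the multiset are those of positive multiplicity.
\<close>

definition dgm :: "(real, 'k::field, 'a) pers_module \<Rightarrow> real \<times> ereal \<Rightarrow> nat"
  where "dgm W = (\<lambda>(s, t). if ereal s < t then
      nat (if t = \<infinity> then multiplicity_inf W s else multiplicity_fin W s (real_of_ereal t))
    else 0)"

definition multi_bijection :: "('a \<Rightarrow> nat) \<Rightarrow> ('b \<Rightarrow> nat) \<Rightarrow> ('a \<Rightarrow> 'b) \<Rightarrow> bool"
  where "multi_bijection M N \<gamma> \<longleftrightarrow>
    bij_betw \<gamma> {p. M p > 0} {q. N q > 0} \<and> (\<forall>p. M p > 0 \<longrightarrow> N (\<gamma> p) = M p)"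

end

theory Submission
  imports Defs
begin

text \<open>
  A finite complex whose simplices outside a subcomplex are all paired by a gradient vector field
  can be collapsed onto the subcomplex by removing free pairs one at a time, so the relative
  homology vanishes. Hence the rank of \<open>H\<^sub>k(K\<^sup>u) \<rightarrow> H\<^sub>k(K\<^sup>v)\<close> depends only on which points of
  \<open>\<C>\<close>, the closure of the critical entrance values under least upper bounds, lie below \<open>u\<close> and
  which lie below \<open>v\<close>. On a line \<open>L\<close> of positive slope a point \<open>c \<in> \<C>\<close> lies below exactly the
  points of \<open>L\<close> from the parameter of its push onwards; so the rank function of \<open>L\<close> is a step
  function with jumps at these parameters. Equivalent lines push \<open>\<C>\<close> in the same order, so their
  rank functions agree after a monotone reparametrization. Since the number of bars born and dying
  in a rectangle is non-negative, the minima defining the multiplicities are attained for all small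
  enough \<open>e\<close>, and so the multiplicities are determined by the values of the steps.
\<close>

section \<open>Relative homology of a complex modulo a subcomplex with the same critical simplices\<close>

text \<open>Only ranks are compared, never the persistence modules themselves, so no isomorphisms
  along the lines have to be constructed or shown to commute with the structure maps. Two obstacles
  shape the proof. Points of \<open>L\<close> and \<open>L'\<close> that lie above the same members
  of the closure are in general incomparable, and neither of their complexes contains the other;
  both are compared with the complex at the infimum of the two points, which has the same critical
  simplices. Moreover, the open faces at two points do not determine the order of their pushes; that
  order is read off at their least upper bound, so the face condition is used on the whole closure.
  The bijection sends a parameter to the \<open>L'\<close>-parameter of its lower projection. This
  projection may differ from the point that caused the jump, but both have the same push on
  \<open>L\<close>, hence also on \<open>L'\<close>.\<close>

lemma mem_chain_space:
  "c \<in> carrier (chain_space K j) \<longleftrightarrow> (\<forall>\<sigma>. c \<sigma> \<noteq> 0 \<longrightarrow> \<sigma> \<in> K \<and> int (card \<sigma>) = j + 1)"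
  by (simp add: chain_space_def)

lemma chain_space_mono:
  "A \<subseteq> B \<Longrightarrow> carrier (chain_space A j) \<subseteq> carrier (chain_space B j)"
  by (simp add: subset_iff mem_chain_space)

lemma complex_finite: "finite_simplicial_complex K \<Longrightarrow> finite K"
  by (simp add: finite_simplicial_complex_def)

lemma complex_simplex: "finite_simplicial_complex K \<Longrightarrow> \<sigma> \<in> K \<Longrightarrow> finite \<sigma> \<and> \<sigma> \<noteq> {}"
  by (simp add: finite_simplicial_complex_def)

lemma complex_face:
  "finite_simplicial_complex K \<Longrightarrow> \<sigma> \<in> K \<Longrightarrow> \<tau> \<noteq> {} \<Longrightarrow> \<tau> \<subseteq> \<sigma> \<Longrightarrow> \<tau> \<in> K"
  unfolding finite_simplicial_complex_def by blast

section \<open>Facets, signs and the boundary operator\<close>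

lemma facet_finite: "facet \<alpha> \<beta> \<Longrightarrow> finite \<beta>"
  unfolding facet_def by (metis Suc_eq_plus1 card.infinite nat.distinct(1))

lemma facet_obtain:
  assumes "facet \<alpha> \<beta>"
  obtains x where "x \<notin> \<alpha>" "\<beta> = insert x \<alpha>"
proof -
  have "finite \<beta>" by (rule facet_finite[OF assms])
  then have "card (\<beta> - \<alpha>) = 1"
    using assms unfolding facet_def by (subst card_Diff_subset) (auto intro: finite_subset)
  then obtain x where "\<beta> - \<alpha> = {x}" by (auto simp: card_1_singleton_iff)
  then show ?thesis using assms that[of x] unfolding facet_def by blast
qed

lemma facet_insert: "finite \<alpha> \<Longrightarrow> x \<notin> \<alpha> \<Longrightarrow> facet \<alpha> (insert x \<alpha>)"
  by (auto simp: facet_def)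

lemma incidence_insert:
  assumes "x \<notin> \<alpha>"
  shows "incidence r \<alpha> (insert x \<alpha>) = (- 1) ^ card {w\<in>\<alpha>. (w, x) \<in> r}"
proof -
  have "insert x \<alpha> - \<alpha> = {x}" using assms by auto
  then show ?thesis by (simp add: incidence_def)
qed

lemma incidence_sq: "incidence r \<alpha> \<beta> * incidence r \<alpha> \<beta> = 1"
  unfolding incidence_def by (simp flip: power_mult_distrib)

lemma incidence_nonzero: "incidence r \<alpha> \<beta> \<noteq> (0 :: 'k::field)"
  by (simp add: incidence_def)

lemma boundary_add:
  "boundary r K (\<lambda>\<sigma>. c \<sigma> + d \<sigma>) = (\<lambda>\<sigma>. boundary r K c \<sigma> + boundary r K d \<sigma>)"
  by (auto simp: boundary_def distrib_left sum.distrib)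

lemma boundary_scale: "boundary r K (\<lambda>\<sigma>. a * c \<sigma>) = (\<lambda>\<sigma>. a * boundary r K c \<sigma>)"
  by (auto simp: boundary_def sum_distrib_left mult_ac)

lemma boundary_0: "boundary r K (\<lambda>_. 0) = (\<lambda>_. 0)"
  by (auto simp: boundary_def)

lemma boundary_chain:
  assumes "c \<in> carrier (chain_space K (j + 1))"
  shows "boundary r K c \<in> carrier (chain_space K j)"
  unfolding mem_chain_space
proof (intro allI impI)
  fix \<alpha> assume *: "boundary r K c \<alpha> \<noteq> 0"
  then have "\<alpha> \<in> K" by (auto simp: boundary_def split: if_splits)
  with * obtain \<beta> where "\<beta> \<in> K" "facet \<alpha> \<beta>" "c \<beta> \<noteq> 0"
    unfolding boundary_def by (auto elim: sum.not_neutral_contains_not_neutral)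
  then show "\<alpha> \<in> K \<and> int (card \<alpha>) = j + 1"
    using assms \<open>\<alpha> \<in> K\<close> unfolding mem_chain_space facet_def by auto
qed

text \<open>The delicate point is a simplex of \<open>B\<close> outside \<open>A\<close>: since
  \<open>A\<close> is closed under faces, its cofaces lie outside \<open>A\<close> too, where
  \<open>c\<close> vanishes.\<close>

lemma boundary_subcomplex:
  assumes "finite_simplicial_complex A" "finite_simplicial_complex B" "A \<subseteq> B"
    "\<And>\<sigma>. c \<sigma> \<noteq> 0 \<Longrightarrow> \<sigma> \<in> A"
  shows "boundary r B c = boundary r A c"
proof
  fix \<alpha>
  consider "\<alpha> \<in> A" | "\<alpha> \<in> B" "\<alpha> \<notin> A" | "\<alpha> \<notin> B" by auto
  then show "boundary r B c \<alpha> = boundary r A c \<alpha>"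
  proof cases
    case 1
    have "(\<Sum>\<beta>\<in>{\<beta>\<in>B. facet \<alpha> \<beta>}. incidence r \<alpha> \<beta> * c \<beta>) =
      (\<Sum>\<beta>\<in>{\<beta>\<in>A. facet \<alpha> \<beta>}. incidence r \<alpha> \<beta> * c \<beta>)"
      using assms by (intro sum.mono_neutral_right) (auto simp: complex_finite)
    then show ?thesis using 1 assms(3) by (auto simp: boundary_def)
  next
    case 2
    have "c \<beta> = 0" if "facet \<alpha> \<beta>" for \<beta>
      using complex_face[OF assms(1), of \<beta> \<alpha>] complex_simplex[OF assms(2), of \<alpha>] 2 that assms(4)[of \<beta>]
      by (auto simp: facet_def)
    then show ?thesis using 2 by (auto simp: boundary_def)
  next
    case 3
    then show ?thesis using assms(3) by (auto simp: boundary_def)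
  qed
qed

lemma boundary_chain_subcomplex:
  assumes "finite_simplicial_complex A" "finite_simplicial_complex B" "A \<subseteq> B"
    "c \<in> carrier (chain_space A j)"
  shows "boundary r B c = boundary r A c"
  using assms by (intro boundary_subcomplex) (auto simp: mem_chain_space)

text \<open>If \<open>x\<close> precedes \<open>y\<close>, inserting \<open>x\<close> adds one
  predecessor to \<open>y\<close>, while inserting \<open>y\<close> adds none to \<open>x\<close>.
  The two products thus differ by exactly one sign.\<close>

lemma incidence_insert_insert:
  assumes lin: "linear_order_on X r" and X: "insert x (insert y \<alpha>) \<subseteq> X"
    and "finite \<alpha>" "x \<notin> \<alpha>" "y \<notin> \<alpha>" "x \<noteq> y"
  shows "incidence r \<alpha> (insert x \<alpha>) * incidence r (insert x \<alpha>) (insert x (insert y \<alpha>)) +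
    incidence r \<alpha> (insert y \<alpha>) * incidence r (insert y \<alpha>) (insert x (insert y \<alpha>)) = (0 :: 'k::field)"
proof -
  define N where "N v \<beta> = card {w\<in>\<beta>. (w, v) \<in> r}" for v \<beta>
  have xy: "(x, y) \<in> r \<and> (y, x) \<notin> r \<or> (y, x) \<in> r \<and> (x, y) \<notin> r"
    using lin X \<open>x \<noteq> y\<close> unfolding linear_order_on_def partial_order_on_def total_on_def antisym_def
    by blast
  have N: "N v (insert u \<alpha>) = (if (u, v) \<in> r then Suc (N v \<alpha>) else N v \<alpha>)" if "u \<notin> \<alpha>" for u v
  proof (cases "(u, v) \<in> r")
    case True
    then have "{w\<in>insert u \<alpha>. (w, v) \<in> r} = insert u {w\<in>\<alpha>. (w, v) \<in> r}" by auto
    then show ?thesis using True that \<open>finite \<alpha>\<close> by (simp add: N_def)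
  next
    case False
    then have "{w\<in>insert u \<alpha>. (w, v) \<in> r} = {w\<in>\<alpha>. (w, v) \<in> r}" by auto
    then show ?thesis using False by (simp add: N_def)
  qed
  have "incidence r (insert x \<alpha>) (insert x (insert y \<alpha>)) = (- 1 :: 'k) ^ N y (insert x \<alpha>)"
    using incidence_insert[of y "insert x \<alpha>" r] assms by (simp add: insert_commute N_def)
  moreover have "incidence r (insert y \<alpha>) (insert x (insert y \<alpha>)) = (- 1 :: 'k) ^ N x (insert y \<alpha>)"
    using incidence_insert[of x "insert y \<alpha>" r] assms by (simp add: N_def)
  ultimately show ?thesis
    using xy assms by (auto simp: incidence_insert N simp flip: N_def)
qed

lemma boundary_boundary:
  assumes K: "finite_simplicial_complex K" and lin: "linear_order_on X r" and X: "\<Union>K \<subseteq> X"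
  shows "boundary r K (boundary r K c) = (\<lambda>_. 0 :: 'k::field)"
proof
  fix \<alpha>
  show "boundary r K (boundary r K c) \<alpha> = 0"
  proof (cases "\<alpha> \<in> K")
    case False
    then show ?thesis by (simp add: boundary_def)
  next
    case True
    then have fin: "finite \<alpha>" "\<alpha> \<noteq> {}" using complex_simplex[OF K] by auto
    \<comment> \<open>Between \<open>\<alpha>\<close> and a simplex with two more vertices there are
      exactly two simplices, one for each vertex added first, and their contributions have opposite
      signs.\<close>
    have cancel: "(\<Sum>\<beta>\<in>{\<beta>\<in>K. facet \<alpha> \<beta> \<and> facet \<beta> \<gamma>}. incidence r \<alpha> \<beta> * incidence r \<beta> \<gamma>) = (0 :: 'k)"
      if "\<gamma> \<in> K" for \<gamma>
    proof (cases "{\<beta>\<in>K. facet \<alpha> \<beta> \<and> facet \<beta> \<gamma>} = {}")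
      case False
      then obtain \<beta> where "facet \<alpha> \<beta>" "facet \<beta> \<gamma>" by blast
      then obtain y x where y: "y \<notin> \<alpha>" and x: "x \<notin> \<alpha>" "x \<noteq> y" and \<gamma>: "\<gamma> = insert x (insert y \<alpha>)"
        by (metis facet_obtain insert_iff)
      have mem: "insert x \<alpha> \<in> K" "insert y \<alpha> \<in> K"
        by (rule complex_face[OF K \<open>\<gamma> \<in> K\<close>]; auto simp: \<gamma>)+
      have "facet (insert x \<alpha>) \<gamma>" "facet (insert y \<alpha>) \<gamma>"
        using facet_insert[of "insert x \<alpha>" y] facet_insert[of "insert y \<alpha>" x] x y fin(1)
        unfolding \<gamma> by (simp_all add: insert_commute[of y x])
      moreover have "facet \<alpha> (insert x \<alpha>)" "facet \<alpha> (insert y \<alpha>)"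
        by (rule facet_insert[OF fin(1)], rule x y)+
      moreover have "\<beta>' = insert x \<alpha> \<or> \<beta>' = insert y \<alpha>" if \<beta>': "facet \<alpha> \<beta>'" "facet \<beta>' \<gamma>" for \<beta>'
      proof -
        obtain z where "z \<notin> \<alpha>" "\<beta>' = insert z \<alpha>" using facet_obtain[OF \<beta>'(1)] .
        moreover have "\<beta>' \<subseteq> \<gamma>" using \<beta>'(2) by (auto simp: facet_def)
        ultimately show ?thesis unfolding \<gamma> by blast
      qed
      ultimately have "{\<beta>\<in>K. facet \<alpha> \<beta> \<and> facet \<beta> \<gamma>} = {insert x \<alpha>, insert y \<alpha>}"
        using mem by blast
      moreover have "insert x \<alpha> \<noteq> insert y \<alpha>" using x y by blast
      moreover have "insert x (insert y \<alpha>) \<subseteq> X" using X \<open>\<gamma> \<in> K\<close> unfolding \<gamma> by blast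
      ultimately show ?thesis
        using incidence_insert_insert[OF lin, of x y \<alpha>] x y fin(1) unfolding \<gamma> by simp
    next
      case True
      then show ?thesis by (simp only: sum.empty)
    qed
    have "boundary r K (boundary r K c) \<alpha> =
      (\<Sum>\<beta>\<in>{\<beta>\<in>K. facet \<alpha> \<beta>}. \<Sum>\<gamma>\<in>{\<gamma>\<in>K. facet \<beta> \<gamma>}. incidence r \<alpha> \<beta> * incidence r \<beta> \<gamma> * c \<gamma>)"
      using True by (auto simp: boundary_def sum_distrib_left mult.assoc intro!: sum.cong)
    also have "\<dots> = (\<Sum>\<gamma>\<in>K. \<Sum>\<beta>\<in>{\<beta>\<in>K. facet \<alpha> \<beta> \<and> facet \<beta> \<gamma>}. incidence r \<alpha> \<beta> * incidence r \<beta> \<gamma> * c \<gamma>)"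
      using complex_finite[OF K] by (subst sum.swap_restrict) (auto simp: conj_ac)
    also have "\<dots> = (\<Sum>\<gamma>\<in>K. (\<Sum>\<beta>\<in>{\<beta>\<in>K. facet \<alpha> \<beta> \<and> facet \<beta> \<gamma>}. incidence r \<alpha> \<beta> * incidence r \<beta> \<gamma>) * c \<gamma>)"
      by (simp add: sum_distrib_right)
    also have "\<dots> = 0" using cancel by simp
    finally show ?thesis .
  qed
qed

section \<open>Free pairs and elementary collapses\<close>

lemma boundary_eq_single:
  assumes "\<alpha> \<in> B" "\<beta> \<in> B" "facet \<alpha> \<beta>" "\<And>\<gamma>. \<gamma> \<in> B \<Longrightarrow> facet \<alpha> \<gamma> \<Longrightarrow> \<gamma> = \<beta>"
  shows "boundary r B c \<alpha> = incidence r \<alpha> \<beta> * c \<beta>"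
proof -
  have "{\<gamma>\<in>B. facet \<alpha> \<gamma>} = {\<beta>}" using assms(2-4) by blast
  then show ?thesis using assms(1) by (simp add: boundary_def)
qed

text \<open>As \<open>\<beta>\<close> is the only simplex of \<open>B\<close> with facet
  \<open>\<alpha>\<close>, the boundary of \<open>c\<close> at \<open>\<alpha>\<close> is
  \<open>c \<beta>\<close> up to sign, so \<open>c \<beta> = 0\<close>. In the degree of
  \<open>\<alpha>\<close>, the coefficient at \<open>\<alpha>\<close> is removed by subtracting the
  boundary of a multiple of \<open>\<beta>\<close>.\<close>

lemma relative_cycle_free_pair:
  fixes c :: "'v set \<Rightarrow> 'k::field"
  assumes pair: "\<alpha> \<in> B" "\<beta> \<in> B" "facet \<alpha> \<beta>" "\<And>\<gamma>. \<gamma> \<in> B \<Longrightarrow> facet \<alpha> \<gamma> \<Longrightarrow> \<gamma> = \<beta>"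
    and c: "c \<in> carrier (chain_space B j)" "boundary r B c \<alpha> = 0"
  obtains c1 b where "c1 \<in> carrier (chain_space (B - {\<alpha>, \<beta>}) j)"
    "b \<in> carrier (chain_space B (j + 1))" "c = (\<lambda>\<sigma>. c1 \<sigma> + boundary r B b \<sigma>)"
proof (cases "int (card \<alpha>) = j + 1")
  case False
  then have "c \<alpha> = 0" using c(1) by (auto simp: mem_chain_space)
  moreover have "c \<beta> = 0"
    using c(2) boundary_eq_single[OF pair] incidence_nonzero by (metis mult_eq_0_iff)
  ultimately have "c \<in> carrier (chain_space (B - {\<alpha>, \<beta>}) j)"
    using c(1) by (auto simp: mem_chain_space)
  then show ?thesis using that[of c "\<lambda>_. 0"] by (auto simp: boundary_0 mem_chain_space)
next
  case True
  \<comment> \<open>Incidence numbers square to 1, so with this coefficient the boundary of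
    \<open>b\<close> takes the value \<open>c \<alpha>\<close> at \<open>\<alpha>\<close>.\<close>
  define b where "b = (\<lambda>\<sigma>. if \<sigma> = \<beta> then incidence r \<alpha> \<beta> * c \<alpha> else 0)"
  have card: "int (card \<beta>) = j + 2" using True pair(3) by (auto simp: facet_def)
  have b: "b \<in> carrier (chain_space B (j + 1))"
    using card pair(2) by (auto simp: mem_chain_space b_def)
  define c1 where "c1 = (\<lambda>\<sigma>. c \<sigma> - boundary r B b \<sigma>)"
  have sq: "incidence r \<alpha> \<beta> * incidence r \<alpha> \<beta> = (1 :: 'k)" by (rule incidence_sq)
  have "boundary r B b \<alpha> = c \<alpha>"
    using boundary_eq_single[OF pair, of r b] sq by (simp add: b_def mult.assoc[symmetric])
  then have "c1 \<alpha> = 0" by (simp add: c1_def)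
  moreover have c1: "c1 \<in> carrier (chain_space B j)"
    using c(1) boundary_chain[OF b, of r] unfolding mem_chain_space c1_def by force
  moreover have "c1 \<beta> = 0" using c1 card by (auto simp: mem_chain_space)
  ultimately have "c1 \<in> carrier (chain_space (B - {\<alpha>, \<beta>}) j)"
    by (auto simp: mem_chain_space)
  then show ?thesis using that[OF _ b] by (simp add: c1_def)
qed

text \<open>Turns the absence of closed V-paths into acyclicity of a relation, hence into
  well-foundedness on finite sets.\<close>

definition V_step :: "('v set \<times> 'v set) set \<Rightarrow> 'v set rel"
  where "V_step V = {(\<alpha>, \<alpha>'). \<exists>\<beta>. (\<alpha>, \<beta>) \<in> V \<and> \<alpha>' \<noteq> \<alpha> \<and> facet \<alpha>' \<beta>}"

lemma acyclic_V_step: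
  assumes "gradient_vector_field K V"
  shows "acyclic (V_step V)"
  unfolding acyclic_def
proof (intro allI notI)
  fix a assume "(a, a) \<in> (V_step V)\<^sup>+"
  then obtain n where n: "n > 0" "(a, a) \<in> V_step V ^^ n" by (auto simp: trancl_power)
  then obtain f where f: "f 0 = a" "f n = a" "\<forall>i<n. (f i, f (Suc i)) \<in> V_step V"
    by (auto simp: relpow_fun_conv)
  from f(3) have "\<forall>i. \<exists>\<beta>. i < n \<longrightarrow> (f i, \<beta>) \<in> V \<and> f (Suc i) \<noteq> f i \<and> facet (f (Suc i)) \<beta>"
    by (auto simp: V_step_def)
  then obtain b where b: "\<And>i. i < n \<Longrightarrow> (f i, b i) \<in> V \<and> f (Suc i) \<noteq> f i \<and> facet (f (Suc i)) (b i)"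
    by metis
  \<comment> \<open>A cycle of \<open>n\<close> steps is a V-path with \<open>r = n - 1\<close>, and
    \<open>gradient_vector_field\<close> only forbids \<open>r > 0\<close>. A loop of one step is
    excluded by \<open>\<alpha>' \<noteq> \<alpha>\<close> instead.\<close>
  have "n \<noteq> 1" using b[of 0] f by auto
  then have "n - 1 > 0" using n by simp
  moreover have "V_path V (n - 1) f b" using b n by (auto simp: V_path_def)
  moreover have "f 0 = f (n - 1 + 1)" using f n by simp
  ultimately show False using assms unfolding gradient_vector_field_def by blast
qed

lemma discrete_vector_fieldD:
  assumes "discrete_vector_field K V" "(\<alpha>, \<beta>) \<in> V"
  shows "facet \<alpha> \<beta>" "(\<alpha>', \<beta>') \<in> V \<Longrightarrow> \<alpha>' = \<alpha> \<or> \<alpha>' = \<beta> \<or> \<beta>' = \<alpha> \<or> \<beta>' = \<beta> \<Longrightarrow> \<alpha>' = \<alpha> \<and> \<beta>' = \<beta>"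
proof -
  show "facet \<alpha> \<beta>" using assms unfolding discrete_vector_field_def by blast
  assume "(\<alpha>', \<beta>') \<in> V" and meet: "\<alpha>' = \<alpha> \<or> \<alpha>' = \<beta> \<or> \<beta>' = \<alpha> \<or> \<beta>' = \<beta>"
  moreover have "\<forall>p\<in>V. \<forall>q\<in>V. p \<noteq> q \<longrightarrow> {fst p, snd p} \<inter> {fst q, snd q} = {}"
    using assms unfolding discrete_vector_field_def by blast
  ultimately have "(\<alpha>', \<beta>') = (\<alpha>, \<beta>) \<or> {\<alpha>', \<beta>'} \<inter> {\<alpha>, \<beta>} = {}"
    using assms(2) by fastforce
  then show "\<alpha>' = \<alpha> \<and> \<beta>' = \<beta>" using meet by blast
qed

text \<open>Among the pairs whose larger simplex has maximal dimension in the difference, a first one along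
  the V-paths is free: another coface of its smaller simplex would be paired to a predecessor.\<close>

lemma free_pair_exists:
  assumes A: "finite_simplicial_complex A" and B: "finite_simplicial_complex B" and "A \<subset> B"
    and V: "gradient_vector_field K V"
    and VA: "\<forall>(\<sigma>, \<tau>)\<in>V. \<sigma> \<in> A \<longleftrightarrow> \<tau> \<in> A" and VB: "\<forall>(\<sigma>, \<tau>)\<in>V. \<sigma> \<in> B \<longleftrightarrow> \<tau> \<in> B"
    and crit: "\<forall>\<sigma>\<in>B - A. \<exists>(\<alpha>, \<beta>)\<in>V. \<sigma> = \<alpha> \<or> \<sigma> = \<beta>"
  obtains \<alpha> \<beta> where "(\<alpha>, \<beta>) \<in> V" "\<alpha> \<in> B - A" "\<beta> \<in> B - A"
    "\<And>\<gamma>. \<gamma> \<in> B \<Longrightarrow> \<alpha> \<subset> \<gamma> \<Longrightarrow> \<gamma> = \<beta>" "\<And>\<gamma>. \<gamma> \<in> B \<Longrightarrow> \<not> \<beta> \<subset> \<gamma>"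
proof -
  have dvf: "discrete_vector_field K V" using V by (simp add: gradient_vector_field_def)
  note facet_V = discrete_vector_fieldD(1)[OF dvf]
  define d where "d = Max (card ` (B - A))"
  have fin: "finite (B - A)" using complex_finite[OF B] by simp
  have le_d: "card \<sigma> \<le> d" if "\<sigma> \<in> B - A" for \<sigma>
    using that fin unfolding d_def by (intro Max_ge) auto
  have "d \<in> card ` (B - A)" using fin \<open>A \<subset> B\<close> unfolding d_def by (intro Max_in) auto
  then obtain \<beta>0 where \<beta>0: "\<beta>0 \<in> B - A" "card \<beta>0 = d" by auto
  \<comment> \<open>A simplex of top cardinality \<open>d\<close> cannot be the smaller member of a
    pair, since its partner would be larger and still lie in \<open>B - A\<close>.\<close>
  have down: "\<exists>\<alpha>. (\<alpha>, \<gamma>) \<in> V" if \<gamma>: "\<gamma> \<in> B - A" "card \<gamma> = d" for \<gamma>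
  proof (rule ccontr)
    assume "\<not> ?thesis"
    then obtain \<delta> where \<delta>: "(\<gamma>, \<delta>) \<in> V" using crit \<gamma> by blast
    then have "\<delta> \<in> B - A" using VA VB \<gamma> by blast
    moreover have "card \<delta> = d + 1" using facet_V[OF \<delta>] \<gamma> by (simp add: facet_def)
    ultimately show False using le_d by fastforce
  qed
  define P where "P = {\<alpha>. \<exists>\<beta>. (\<alpha>, \<beta>) \<in> V \<and> \<beta> \<in> B - A \<and> card \<beta> = d}"
  have "P \<subseteq> B" using VB by (auto simp: P_def)
  then have "finite P" using complex_finite[OF B] finite_subset by blast
  have "P \<noteq> {}" using \<beta>0 down[of \<beta>0] by (auto simp: P_def)
  have "wf (V_step V \<inter> P \<times> P)"
    using acyclic_V_step[OF V] \<open>finite P\<close>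
    by (intro finite_acyclic_wf) (auto intro: acyclic_subset)
  then obtain \<alpha> where \<alpha>: "\<alpha> \<in> P" "\<And>\<alpha>'. (\<alpha>', \<alpha>) \<in> V_step V \<inter> P \<times> P \<Longrightarrow> \<alpha>' \<notin> P"
    using \<open>P \<noteq> {}\<close> by (metis wfE_min ex_in_conv)
  then obtain \<beta> where \<beta>: "(\<alpha>, \<beta>) \<in> V" "\<beta> \<in> B - A" "card \<beta> = d" by (auto simp: P_def)
  have \<alpha>_mem: "\<alpha> \<in> B - A" using VA VB \<beta> by blast
  show thesis
  proof (rule that[OF \<beta>(1) \<alpha>_mem \<beta>(2)])
    fix \<gamma> assume \<gamma>: "\<gamma> \<in> B" "\<alpha> \<subset> \<gamma>"
    have "\<gamma> \<in> B - A"
      using \<gamma> \<alpha>_mem complex_face[OF A, of \<gamma> \<alpha>] complex_simplex[OF B, of \<alpha>] by auto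
    moreover have "card \<alpha> < card \<gamma>"
      using \<gamma> complex_simplex[OF B] by (intro psubset_card_mono) auto
    moreover have "d = card \<alpha> + 1" using facet_V[OF \<beta>(1)] \<beta>(3) by (simp add: facet_def)
    ultimately have card_\<gamma>: "\<gamma> \<in> B - A" "card \<gamma> = d" "facet \<alpha> \<gamma>"
      using le_d[of \<gamma>] \<gamma> by (auto simp: facet_def)
    then obtain \<alpha>1 where \<alpha>1: "(\<alpha>1, \<gamma>) \<in> V" using down by blast
    then have "\<alpha>1 \<in> P" using card_\<gamma> by (auto simp: P_def)
    moreover have "(\<alpha>1, \<alpha>) \<in> V_step V" if "\<alpha>1 \<noteq> \<alpha>"
      using \<alpha>1 card_\<gamma>(3) that by (auto simp: V_step_def)
    ultimately have "\<alpha>1 = \<alpha>" using \<alpha> by blast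
    then show "\<gamma> = \<beta>" using discrete_vector_fieldD(2)[OF dvf \<beta>(1) \<alpha>1] by blast
  next
    fix \<gamma> assume \<gamma>: "\<gamma> \<in> B"
    show "\<not> \<beta> \<subset> \<gamma>"
    proof
      assume "\<beta> \<subset> \<gamma>"
      then have "\<gamma> \<in> B - A"
        using \<gamma> \<beta>(2) complex_face[OF A, of \<gamma> \<beta>] complex_simplex[OF B, of \<beta>] by auto
      moreover have "card \<beta> < card \<gamma>"
        using \<gamma> \<open>\<beta> \<subset> \<gamma>\<close> complex_simplex[OF B] by (intro psubset_card_mono) auto
      ultimately show False using le_d \<beta>(3) by fastforce
    qed
  qed
qed

text \<open>Removing a free pair changes \<open>c\<close> by a boundary only, so the boundary of
  \<open>c\<close> stays in \<open>A\<close> and the removal can be repeated until \<open>B\<close>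
  has shrunk to \<open>A\<close>.\<close>

lemma relative_homology_trivial:
  fixes c :: "'v set \<Rightarrow> 'k::field"
  assumes A: "finite_simplicial_complex A" and B: "finite_simplicial_complex B" and "A \<subseteq> B"
    and lin: "linear_order_on X r" and X: "\<Union>B \<subseteq> X"
    and V: "gradient_vector_field K V"
    and VA: "\<forall>(\<sigma>, \<tau>)\<in>V. \<sigma> \<in> A \<longleftrightarrow> \<tau> \<in> A" and VB: "\<forall>(\<sigma>, \<tau>)\<in>V. \<sigma> \<in> B \<longleftrightarrow> \<tau> \<in> B"
    and crit: "\<forall>\<sigma>\<in>B - A. \<exists>(\<alpha>, \<beta>)\<in>V. \<sigma> = \<alpha> \<or> \<sigma> = \<beta>"
    and c: "c \<in> carrier (chain_space B j)" "\<And>\<sigma>. boundary r B c \<sigma> \<noteq> 0 \<Longrightarrow> \<sigma> \<in> A"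
  obtains c' b where "c' \<in> carrier (chain_space A j)" "b \<in> carrier (chain_space B (j + 1))"
    "c = (\<lambda>\<sigma>. c' \<sigma> + boundary r B b \<sigma>)"
proof -
  have "\<exists>c'\<in>carrier (chain_space A j). \<exists>b\<in>carrier (chain_space B (j + 1)).
    c = (\<lambda>\<sigma>. c' \<sigma> + boundary r B b \<sigma>)"
    using B \<open>A \<subseteq> B\<close> X VB crit c
  proof (induction "card (B - A)" arbitrary: B c rule: less_induct)
    case less
    note B = less.prems(1)
    show ?case
    proof (cases "A = B")
      case True
      then show ?thesis using less.prems(6)
        by (intro bexI[of _ c] bexI[of _ "\<lambda>_. 0"]) (auto simp: boundary_0 mem_chain_space)
    next
      case False
      with less.prems(2) have "A \<subset> B" by auto
      from free_pair_exists[OF A B this V VA less.prems(4,5)] obtain \<alpha> \<beta> where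
        pair: "(\<alpha>, \<beta>) \<in> V" "\<alpha> \<in> B - A" "\<beta> \<in> B - A" and
        free: "\<And>\<gamma>. \<gamma> \<in> B \<Longrightarrow> \<alpha> \<subset> \<gamma> \<Longrightarrow> \<gamma> = \<beta>" "\<And>\<gamma>. \<gamma> \<in> B \<Longrightarrow> \<not> \<beta> \<subset> \<gamma>" by blast
      have dvf: "discrete_vector_field K V" using V by (simp add: gradient_vector_field_def)
      have fac: "facet \<alpha> \<beta>" using discrete_vector_fieldD(1)[OF dvf pair(1)] .
      define B1 where "B1 = B - {\<alpha>, \<beta>}"
      have B1: "finite_simplicial_complex B1"
        unfolding finite_simplicial_complex_def
      proof (intro conjI ballI allI impI)
        show "finite B1" using complex_finite[OF B] by (simp add: B1_def)
        fix \<sigma> assume \<sigma>: "\<sigma> \<in> B1"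
        then show "finite \<sigma>" "\<sigma> \<noteq> {}" using complex_simplex[OF B] by (auto simp: B1_def)
        fix \<tau> assume "\<tau> \<noteq> {} \<and> \<tau> \<subseteq> \<sigma>"
        then show "\<tau> \<in> B1"
          using \<sigma> complex_face[OF B, of \<sigma> \<tau>] free[of \<sigma>] unfolding B1_def by blast
      qed
      have "A \<subseteq> B1" "B1 \<subseteq> B" using \<open>A \<subset> B\<close> pair by (auto simp: B1_def)
      obtain c1 b1 where c1: "c1 \<in> carrier (chain_space B1 j)"
        and b1: "b1 \<in> carrier (chain_space B (j + 1))" and eq: "c = (\<lambda>\<sigma>. c1 \<sigma> + boundary r B b1 \<sigma>)"
      proof (rule relative_cycle_free_pair[OF _ _ fac _ less.prems(6)])
        show "boundary r B c \<alpha> = 0" using less.prems(7)[of \<alpha>] pair by blast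
        show "\<gamma> = \<beta>" if "\<gamma> \<in> B" "facet \<alpha> \<gamma>" for \<gamma>
          using free(1) that by (simp add: facet_def)
      qed (use pair in \<open>auto simp: B1_def\<close>)
      have "boundary r B1 c1 = boundary r B c1"
        using boundary_chain_subcomplex[OF B1 B \<open>B1 \<subseteq> B\<close> c1] by simp
      also have "\<dots> = boundary r B c"
        unfolding eq boundary_add boundary_boundary[OF B lin less.prems(3)] by simp
      finally have bd: "boundary r B1 c1 = boundary r B c" .
      have "\<exists>c'\<in>carrier (chain_space A j). \<exists>b\<in>carrier (chain_space B1 (j + 1)).
        c1 = (\<lambda>\<sigma>. c' \<sigma> + boundary r B1 b \<sigma>)"
      proof (rule less.hyps)
        show "card (B1 - A) < card (B - A)"
          using complex_finite[OF B] pair by (intro psubset_card_mono) (auto simp: B1_def)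
        \<comment> \<open>Pairs are disjoint, so deleting both members of one pair splits no other
          pair.\<close>
        show "\<forall>(\<sigma>, \<tau>)\<in>V. (\<sigma> \<in> B1) = (\<tau> \<in> B1)"
        proof (intro ballI, clarify)
          fix \<sigma> \<tau> assume st: "(\<sigma>, \<tau>) \<in> V"
          then have "\<sigma> \<in> B \<longleftrightarrow> \<tau> \<in> B" using less.prems(4) by blast
          moreover have "\<sigma> \<in> {\<alpha>, \<beta>} \<longleftrightarrow> \<tau> \<in> {\<alpha>, \<beta>}"
            using discrete_vector_fieldD(2)[OF dvf pair(1) st] by blast
          ultimately show "\<sigma> \<in> B1 \<longleftrightarrow> \<tau> \<in> B1" by (auto simp: B1_def)
        qed
        show "\<And>\<sigma>. boundary r B1 c1 \<sigma> \<noteq> 0 \<Longrightarrow> \<sigma> \<in> A" unfolding bd by (rule less.prems(7))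
        show "\<Union>B1 \<subseteq> X" using \<open>B1 \<subseteq> B\<close> less.prems(3) by blast
        show "\<forall>\<sigma>\<in>B1 - A. \<exists>(\<alpha>, \<beta>)\<in>V. \<sigma> = \<alpha> \<or> \<sigma> = \<beta>"
          using \<open>B1 \<subseteq> B\<close> less.prems(5) by blast
      qed (fact B1 \<open>A \<subseteq> B1\<close> c1)+
      then obtain c' b where c': "c' \<in> carrier (chain_space A j)"
        and b: "b \<in> carrier (chain_space B1 (j + 1))" and eq1: "c1 = (\<lambda>\<sigma>. c' \<sigma> + boundary r B1 b \<sigma>)"
        by blast
      have "b \<in> carrier (chain_space B (j + 1))" using b chain_space_mono[OF \<open>B1 \<subseteq> B\<close>] by blast
      then have "(\<lambda>\<sigma>. b \<sigma> + b1 \<sigma>) \<in> carrier (chain_space B (j + 1))"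
        using b1 unfolding mem_chain_space by (metis add.right_neutral)
      moreover have "c = (\<lambda>\<sigma>. c' \<sigma> + boundary r B (\<lambda>\<sigma>. b \<sigma> + b1 \<sigma>) \<sigma>)"
        unfolding boundary_add boundary_chain_subcomplex[OF B1 B \<open>B1 \<subseteq> B\<close> b]
        by (simp add: eq eq1 add.assoc)
      ultimately show ?thesis using c' by blast
    qed
  qed
  then show thesis using that by blast
qed

section \<open>Dimensions of images in homology\<close>

text \<open>Sets independent in \<open>W\<close> are independent in the ambient space, which bounds
  their size; hence a maximal one exists and is a basis of \<open>W\<close>.\<close>

lemma (in vectorspace) subspace_fin_dim:
  assumes W: "subspace K W V" and fin: "fin_dim"
  shows "vectorspace.fin_dim K (vs W)" "vectorspace.dim K (vs W) \<le> dim"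
proof -
  interpret W: vectorspace K "vs W" by (rule subspace_is_vs[OF W])
  have sub: "W \<subseteq> carrier V" using W by (simp add: subspace_def submodule_def)
  have li: "lin_indpt S" if "S \<subseteq> W" "W.lin_indpt S" for S
    using span_li_not_depend(2)[of S W] that W by (simp add: subspace_def)
  have "\<exists>S. finite S \<and> maximal S (\<lambda>S. S \<subseteq> carrier (vs W) \<and> W.lin_indpt S)"
  proof (rule maximal_exists[where B = "{}" and N = dim])
    show "finite S \<and> card S \<le> dim" if "S \<subseteq> carrier (vs W) \<and> W.lin_indpt S" for S
      using li_le_dim[OF fin, of S] li[of S] that sub by auto
    show "{} \<subseteq> carrier (vs W) \<and> W.lin_indpt {}" by (simp add: W.lin_dep_def)
  qed
  then obtain S where S: "finite S" "W.basis S" using W.max_li_is_basis by blast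
  then show "W.fin_dim" unfolding W.fin_dim_def W.basis_def by blast
  show "W.dim \<le> dim"
    using W.dim_basis[OF S] li_le_dim(2)[OF fin, of S] li[of S] S(2) sub
    by (auto simp: W.basis_def)
qed

text \<open>The vector space axioms of \<open>N\<close> are inherited through the surjection
  \<open>f\<close>, so for a quotient record only the operations on images have to be
  checked.\<close>

lemma linear_map_onto:
  assumes M: "vectorspace R M" and carrier: "carrier N = f ` carrier M"
    and add: "\<And>x y. x \<in> carrier M \<Longrightarrow> y \<in> carrier M \<Longrightarrow> f x \<oplus>\<^bsub>N\<^esub> f y = f (x \<oplus>\<^bsub>M\<^esub> y)"
    and smult: "\<And>a x. a \<in> carrier R \<Longrightarrow> x \<in> carrier M \<Longrightarrow> a \<odot>\<^bsub>N\<^esub> f x = f (a \<odot>\<^bsub>M\<^esub> x)"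
    and zero: "\<zero>\<^bsub>N\<^esub> = f \<zero>\<^bsub>M\<^esub>"
  shows "linear_map R M N f"
proof -
  interpret M: vectorspace R M by (rule M)
  have "vectorspace R N"
  proof (rule vs_criteria)
    show "field R" by unfold_locales
    show "\<forall>v\<in>carrier N. \<exists>neg_v\<in>carrier N. v \<oplus>\<^bsub>N\<^esub> neg_v = \<zero>\<^bsub>N\<^esub>"
    proof
      fix v assume "v \<in> carrier N"
      then obtain x where x: "x \<in> carrier M" "v = f x" by (auto simp: carrier)
      then have "v \<oplus>\<^bsub>N\<^esub> f (\<ominus>\<^bsub>M\<^esub> x) = \<zero>\<^bsub>N\<^esub>" by (simp add: add zero M.M.r_neg)
      then show "\<exists>neg_v\<in>carrier N. v \<oplus>\<^bsub>N\<^esub> neg_v = \<zero>\<^bsub>N\<^esub>" using x(1) by (auto simp: carrier)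
    qed
  qed (auto simp: carrier zero add smult M.M.a_ac M.smult_assoc1
      M.smult_l_distr M.smult_r_distr)
  moreover have "f \<in> module_hom R M N"
    unfolding module_hom_def by (auto simp: carrier add smult)
  ultimately show ?thesis
    using M by (simp add: linear_map_def mod_hom_def mod_hom_axioms_def vectorspace_def)
qed

section \<open>Subspaces of chains and their images modulo a subspace\<close>

lemma field_coeff_field: "field (coeff_field :: 'k::field ring)"
proof -
  have *: "\<exists>y. y * x = 1" "\<exists>y. x * y = 1" if "x \<noteq> 0" for x :: 'k
    using that by (metis left_inverse, metis right_inverse)
  have "\<exists>y. x + y = 0 \<and> y + x = 0" for x :: 'k by (intro exI[of _ "- x"]) simp
  then show ?thesis
    by unfold_locales (auto simp: algebra_simps Units_def * )
qed

text \<open>A predicate independent of complex and degree: cycles and boundaries of different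
  complexes sit in one function space and can be intersected.\<close>

definition lin_closed :: "('s \<Rightarrow> 'k::field) set \<Rightarrow> bool"
  where "lin_closed X \<longleftrightarrow> (\<lambda>_. 0) \<in> X \<and> (\<forall>c\<in>X. \<forall>d\<in>X. (\<lambda>\<sigma>. c \<sigma> + d \<sigma>) \<in> X) \<and>
    (\<forall>a. \<forall>c\<in>X. (\<lambda>\<sigma>. a * c \<sigma>) \<in> X)"

lemma lin_closedD:
  assumes "lin_closed X"
  shows "(\<lambda>_. 0) \<in> X" "c \<in> X \<Longrightarrow> d \<in> X \<Longrightarrow> (\<lambda>\<sigma>. c \<sigma> + d \<sigma>) \<in> X"
    "c \<in> X \<Longrightarrow> (\<lambda>\<sigma>. a * c \<sigma>) \<in> X" "c \<in> X \<Longrightarrow> d \<in> X \<Longrightarrow> (\<lambda>\<sigma>. c \<sigma> - d \<sigma>) \<in> X"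
    "c \<in> X \<Longrightarrow> (\<lambda>\<sigma>. - c \<sigma>) \<in> X"
proof -
  show 1: "(\<lambda>_. 0) \<in> X" "c \<in> X \<Longrightarrow> d \<in> X \<Longrightarrow> (\<lambda>\<sigma>. c \<sigma> + d \<sigma>) \<in> X" "c \<in> X \<Longrightarrow> (\<lambda>\<sigma>. a * c \<sigma>) \<in> X"
    for a c d using assms by (auto simp: lin_closed_def)
  show 2: "c \<in> X \<Longrightarrow> (\<lambda>\<sigma>. - c \<sigma>) \<in> X" for c using 1(3)[of c "- 1"] by simp
  show "c \<in> X \<Longrightarrow> d \<in> X \<Longrightarrow> (\<lambda>\<sigma>. c \<sigma> - d \<sigma>) \<in> X" using 1(2)[OF _ 2, of c d] by simp
qed

lemma lin_closed_Int: "lin_closed X \<Longrightarrow> lin_closed Y \<Longrightarrow> lin_closed (X \<inter> Y)"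
  by (simp add: lin_closed_def)

lemma lin_closed_chain_space: "lin_closed (carrier (chain_space K k))"
  unfolding lin_closed_def
proof (intro conjI ballI allI)
  fix c d :: "'a set \<Rightarrow> 'b" assume "c \<in> carrier (chain_space K k)" "d \<in> carrier (chain_space K k)"
  moreover have "c \<sigma> \<noteq> 0 \<or> d \<sigma> \<noteq> 0" if "c \<sigma> + d \<sigma> \<noteq> 0" for \<sigma> using that by auto
  ultimately show "(\<lambda>\<sigma>. c \<sigma> + d \<sigma>) \<in> carrier (chain_space K k)"
    unfolding mem_chain_space by blast
qed (simp_all add: mem_chain_space)

lemma lin_closed_cycles: "lin_closed (cycles r K k)"
  using lin_closedD[OF lin_closed_chain_space]
  by (auto simp: lin_closed_def cycles_def boundary_0 boundary_add boundary_scale)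

lemma lin_closed_boundaries: "lin_closed (boundaries r K k)"
proof -
  note D = lin_closedD[OF lin_closed_chain_space[of K "k + 1"]]
  have "(\<lambda>_. 0) \<in> boundaries r K k"
    unfolding boundaries_def by (rule image_eqI[OF _ D(1)]) (simp add: boundary_0)
  moreover have "(\<lambda>\<sigma>. boundary r K c \<sigma> + boundary r K d \<sigma>) \<in> boundaries r K k"
    if "c \<in> carrier (chain_space K (k + 1))" "d \<in> carrier (chain_space K (k + 1))" for c d
    unfolding boundaries_def by (rule image_eqI[OF _ D(2)[OF that]]) (simp add: boundary_add)
  moreover have "(\<lambda>\<sigma>. a * boundary r K c \<sigma>) \<in> boundaries r K k"
    if "c \<in> carrier (chain_space K (k + 1))" for a c
    unfolding boundaries_def by (rule image_eqI[OF _ D(3)[OF that]]) (simp add: boundary_scale)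
  ultimately show ?thesis by (auto simp: lin_closed_def boundaries_def)
qed

text \<open>The operations of \<open>chain_space K k\<close> depend neither on \<open>K\<close> nor on \<open>k\<close>, so \<open>{}\<close> and \<open>0\<close> are
  arbitrary here.\<close>

definition chain_subspace :: "('v set \<Rightarrow> 'k::field) set \<Rightarrow> ('k, 'v set \<Rightarrow> 'k) module"
  where "chain_subspace X = (chain_space {} 0)\<lparr>carrier := X\<rparr>"

lemma chain_space_update: "(chain_space K k)\<lparr>carrier := X\<rparr> = chain_subspace X"
  by (simp add: chain_subspace_def chain_space_def)

lemma chain_subspace_simps [simp]:
  "carrier (chain_subspace X) = X" "zero (chain_subspace X) = (\<lambda>_. 0)"
  "add (chain_subspace X) c d = (\<lambda>\<sigma>. c \<sigma> + d \<sigma>)" "smult (chain_subspace X) a c = (\<lambda>\<sigma>. a * c \<sigma>)"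
  "(chain_subspace X)\<lparr>carrier := Y\<rparr> = chain_subspace Y"
  by (simp_all add: chain_subspace_def chain_space_def)

lemma add_chain_subspace: "add (chain_subspace X) = (\<lambda>c d \<sigma>. c \<sigma> + d \<sigma>)"
  by (simp add: chain_subspace_def chain_space_def)

lemma vectorspace_chain_subspace:
  assumes "lin_closed X"
  shows "vectorspace coeff_field (chain_subspace X)"
proof (rule vs_criteria)
  show "\<forall>v\<in>carrier (chain_subspace X). \<exists>neg_v\<in>carrier (chain_subspace X).
      v \<oplus>\<^bsub>chain_subspace X\<^esub> neg_v = \<zero>\<^bsub>chain_subspace X\<^esub>"
  proof
    fix v assume "v \<in> carrier (chain_subspace X)"
    then show "\<exists>neg_v\<in>carrier (chain_subspace X). v \<oplus>\<^bsub>chain_subspace X\<^esub> neg_v = \<zero>\<^bsub>chain_subspace X\<^esub>"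
      using lin_closedD(5)[OF assms, of v] by (intro bexI[of _ "\<lambda>\<sigma>. - v \<sigma>"]) auto
  qed
qed (use lin_closedD[OF assms] in \<open>auto simp: field_coeff_field algebra_simps\<close>)

lemma subspace_chain_subspace:
  assumes "lin_closed X" "lin_closed Y" "X \<subseteq> Y"
  shows "subspace coeff_field X (chain_subspace Y)"
  using vectorspace_chain_subspace[OF assms(2)] assms lin_closedD[OF assms(1)]
  by (auto simp: subspace_def submodule_def vectorspace_def)

lemma fin_dim_chain_space:
  assumes "finite K"
  shows "vectorspace.fin_dim coeff_field (chain_subspace (carrier (chain_space K k)) :: ('k::field, 'v set \<Rightarrow> 'k) module)"
proof -
  define X where "X = (carrier (chain_space K k) :: ('v set \<Rightarrow> 'k) set)"
  interpret X: vectorspace coeff_field "chain_subspace X"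
    unfolding X_def by (intro vectorspace_chain_subspace lin_closed_chain_space)
  define S where "S = {\<sigma>\<in>K. int (card \<sigma>) = k + 1}"
  define \<delta> :: "'v set \<Rightarrow> 'v set \<Rightarrow> 'k" where "\<delta> = (\<lambda>\<sigma> \<tau>. if \<tau> = \<sigma> then 1 else 0)"
  have "finite S" using assms by (simp add: S_def)
  have X: "c \<in> X \<longleftrightarrow> (\<forall>\<sigma>. c \<sigma> \<noteq> 0 \<longrightarrow> \<sigma> \<in> S)" for c
    by (auto simp: X_def S_def mem_chain_space)
  have \<delta>: "\<delta> ` S \<subseteq> X" unfolding image_subset_iff X by (auto simp: \<delta>_def)
  have sm: "submodule coeff_field (X.span (\<delta> ` S)) (chain_subspace X)"
    using X.span_is_submodule[of "\<delta> ` S"] \<delta> by simp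
  have own: "\<delta> ` S \<subseteq> X.span (\<delta> ` S)" using X.in_own_span[of "\<delta> ` S"] \<delta> by simp
  \<comment> \<open>Induction on a finite set containing the support of \<open>c\<close>; each step
    splits off the value at one simplex as a multiple of its indicator function.\<close>
  have "c \<in> X.span (\<delta> ` S)" if "finite T" "\<And>\<sigma>. c \<sigma> \<noteq> 0 \<Longrightarrow> \<sigma> \<in> T" "T \<subseteq> S" for c T
    using that
  proof (induction T arbitrary: c rule: finite_induct)
    case empty
    then have "c = (\<lambda>_. 0)" by auto
    then show ?case using submodule.zero_closed[OF sm] by simp
  next
    case (insert x T)
    have "c(x := 0) \<in> X.span (\<delta> ` S)" using insert.prems by (intro insert.IH) (auto split: if_splits)
    moreover have "\<delta> x \<in> X.span (\<delta> ` S)" using own insert.prems(2) by blast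
    then have "(\<lambda>\<tau>. c x * \<delta> x \<tau>) \<in> X.span (\<delta> ` S)"
      using submodule.smult_closed[OF sm, of "c x" "\<delta> x"] by simp
    ultimately have "(\<lambda>\<tau>. (c(x := 0)) \<tau> + c x * \<delta> x \<tau>) \<in> X.span (\<delta> ` S)"
      using submodule.m_closed[OF sm, of "c(x := 0)" "\<lambda>\<tau>. c x * \<delta> x \<tau>"] by simp
    moreover have "(\<lambda>\<tau>. (c(x := 0)) \<tau> + c x * \<delta> x \<tau>) = c" by (auto simp: \<delta>_def)
    ultimately show ?case by simp
  qed
  from this[OF \<open>finite S\<close>] have "X \<subseteq> X.span (\<delta> ` S)" by (auto simp: X)
  then have "X.span (\<delta> ` S) = X" using X.span_is_subset2[of "\<delta> ` S"] \<delta> by auto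
  then show ?thesis
    using \<delta> \<open>finite S\<close> unfolding X.fin_dim_def X_def[symmetric]
    by (intro exI[of _ "\<delta> ` S"]) auto
qed

definition chain_dim :: "('v set \<Rightarrow> 'k::field) set \<Rightarrow> nat"
  where "chain_dim X = vectorspace.dim coeff_field (chain_subspace X)"

definition coset :: "('v set \<Rightarrow> 'k::field) set \<Rightarrow> ('v set \<Rightarrow> 'k) \<Rightarrow> ('v set \<Rightarrow> 'k) set"
  where "coset Q z = (\<lambda>q \<sigma>. q \<sigma> + z \<sigma>) ` Q"

text \<open>For subspaces this is \<open>(X + Q) / Q\<close>. The set \<open>Q\<close> may reach
  outside \<open>X\<close>, as the boundaries of a large complex do relative to the cycles of a
  small one.\<close>

definition coset_space :: "('v set \<Rightarrow> 'k::field) set \<Rightarrow> ('v set \<Rightarrow> 'k) set \<Rightarrow> ('k, ('v set \<Rightarrow> 'k) set) module"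
  where "coset_space Q X = (quotient_space (chain_subspace UNIV) Q)\<lparr>carrier := coset Q ` X\<rparr>"

lemma r_coset_chain: "Q +>\<^bsub>chain_subspace X\<^esub> z = coset Q z"
  by (auto simp: a_r_coset_def r_coset_def coset_def)

lemma r_coset_chain_space: "Q +>\<^bsub>chain_space K k\<^esub> z = coset Q z"
  by (auto simp: a_r_coset_def r_coset_def coset_def chain_space_def)

lemma mem_coset: "y \<in> coset Q z \<longleftrightarrow> (\<lambda>\<sigma>. y \<sigma> - z \<sigma>) \<in> Q"
proof
  assume "(\<lambda>\<sigma>. y \<sigma> - z \<sigma>) \<in> Q"
  then show "y \<in> coset Q z" unfolding coset_def by (rule image_eqI[rotated]) simp
qed (auto simp: coset_def)

lemma coset_eq_iff:
  assumes "lin_closed Q"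
  shows "coset Q y = coset Q z \<longleftrightarrow> (\<lambda>\<sigma>. y \<sigma> - z \<sigma>) \<in> Q"
proof
  assume "coset Q y = coset Q z"
  moreover have "y \<in> coset Q y" using lin_closedD(1)[OF assms] by (simp add: mem_coset)
  ultimately show "(\<lambda>\<sigma>. y \<sigma> - z \<sigma>) \<in> Q" by (simp add: mem_coset)
next
  assume yz: "(\<lambda>\<sigma>. y \<sigma> - z \<sigma>) \<in> Q"
  show "coset Q y = coset Q z"
  proof (intro equalityI subsetI)
    fix x assume "x \<in> coset Q y"
    then show "x \<in> coset Q z" using lin_closedD(2)[OF assms _ yz, of "\<lambda>\<sigma>. x \<sigma> - y \<sigma>"] by (simp add: mem_coset)
  next
    fix x assume "x \<in> coset Q z"
    then show "x \<in> coset Q y" using lin_closedD(4)[OF assms _ yz, of "\<lambda>\<sigma>. x \<sigma> - z \<sigma>"] by (simp add: mem_coset)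
  qed
qed

lemma coset_add:
  assumes "lin_closed Q"
  shows "coset Q x <+>\<^bsub>chain_subspace Y\<^esub> coset Q y = coset Q (\<lambda>\<sigma>. x \<sigma> + y \<sigma>)"
proof (intro equalityI subsetI)
  fix z assume "z \<in> coset Q x <+>\<^bsub>chain_subspace Y\<^esub> coset Q y"
  then obtain a b where "a \<in> coset Q x" "b \<in> coset Q y" and z: "z = (\<lambda>\<sigma>. a \<sigma> + b \<sigma>)"
    by (auto simp: set_add_def set_mult_def)
  then have "(\<lambda>\<sigma>. (a \<sigma> - x \<sigma>) + (b \<sigma> - y \<sigma>)) \<in> Q"
    using lin_closedD(2)[OF assms] by (simp add: mem_coset)
  then show "z \<in> coset Q (\<lambda>\<sigma>. x \<sigma> + y \<sigma>)" by (simp add: mem_coset z algebra_simps)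
next
  fix z assume z: "z \<in> coset Q (\<lambda>\<sigma>. x \<sigma> + y \<sigma>)"
  then have "(\<lambda>\<sigma>. z \<sigma> - y \<sigma>) \<in> coset Q x" by (simp add: mem_coset algebra_simps)
  moreover have "y \<in> coset Q y" using lin_closedD(1)[OF assms] by (simp add: mem_coset)
  ultimately show "z \<in> coset Q x <+>\<^bsub>chain_subspace Y\<^esub> coset Q y"
    by (auto simp: set_add_def set_mult_def intro!: bexI)
qed

lemma coset_smult:
  assumes "lin_closed Q"
  shows "(\<Union>y\<in>coset Q x. coset Q (\<lambda>\<sigma>. a * y \<sigma>)) = coset Q (\<lambda>\<sigma>. a * x \<sigma>)"
proof -
  have "coset Q (\<lambda>\<sigma>. a * y \<sigma>) = coset Q (\<lambda>\<sigma>. a * x \<sigma>)" if "y \<in> coset Q x" for y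
    using lin_closedD(3)[OF assms, of "\<lambda>\<sigma>. y \<sigma> - x \<sigma>" a] that
    by (simp add: coset_eq_iff[OF assms] mem_coset algebra_simps)
  moreover have "x \<in> coset Q x" using lin_closedD(1)[OF assms] by (simp add: mem_coset)
  ultimately show ?thesis by blast
qed

lemma coset_zero: "coset Q (\<lambda>_. 0) = Q"
  by (simp add: coset_def)

lemma coset_space_simps:
  assumes "lin_closed Q"
  shows "carrier (coset_space Q X) = coset Q ` X" "zero (coset_space Q X) = Q"
    "add (coset_space Q X) (coset Q x) (coset Q y) = coset Q (\<lambda>\<sigma>. x \<sigma> + y \<sigma>)"
    "smult (coset_space Q X) a (coset Q x) = coset Q (\<lambda>\<sigma>. a * x \<sigma>)"
    "(coset_space Q X)\<lparr>carrier := coset Q ` Y\<rparr> = coset_space Q Y"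
  using assms by (simp_all add: coset_space_def quotient_space_def r_coset_chain coset_add coset_smult)

lemma linear_map_coset:
  assumes Q: "lin_closed Q" and X: "lin_closed X"
  shows "linear_map coeff_field (chain_subspace X) (coset_space Q X) (coset Q)"
  by (rule linear_map_onto[OF vectorspace_chain_subspace[OF X]])
    (simp_all add: coset_space_simps[OF Q] coset_zero)

text \<open>Rank-nullity for the map \<open>coset Q\<close> on \<open>X\<close>, whose kernel is
  \<open>X \<inter> Q\<close>.\<close>

lemma dim_coset_space:
  fixes Q X :: "('v set \<Rightarrow> 'k::field) set"
  assumes Q: "lin_closed Q" and X: "lin_closed X" "X \<subseteq> carrier (chain_space K k)" and "finite K"
  shows "vectorspace.fin_dim coeff_field (coset_space Q X)"
    "vectorspace.dim coeff_field (coset_space Q X) + chain_dim (X \<inter> Q) = chain_dim X"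
proof -
  interpret linear_map coeff_field "chain_subspace X" "coset_space Q X" "coset Q"
    by (rule linear_map_coset[OF Q X(1)])
  interpret C: vectorspace coeff_field "chain_subspace (carrier (chain_space K k)) :: ('k, 'v set \<Rightarrow> 'k) module"
    by (intro vectorspace_chain_subspace lin_closed_chain_space)
  have fin: "V.fin_dim"
    using C.subspace_fin_dim(1)[OF subspace_chain_subspace[OF X(1) lin_closed_chain_space X(2)]
        fin_dim_chain_space[OF \<open>finite K\<close>]] by simp
  have onto: "coset Q ` carrier (chain_subspace X) = carrier (coset_space Q X)"
    by (simp add: coset_space_simps[OF Q])
  show "W.fin_dim" by (rule rank_nullity_main(2)[OF fin onto])
  have "ker = X \<inter> Q"
    using coset_eq_iff[OF Q, of _ "\<lambda>_. 0"] by (auto simp: ker_def coset_space_simps[OF Q] coset_zero)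
  moreover have "im = coset Q ` X" by (simp add: im_def)
  ultimately show "W.dim + chain_dim (X \<inter> Q) = chain_dim X"
    using rank_nullity[OF fin] by (simp add: chain_dim_def coset_space_simps[OF Q])
qed

lemma dim_coset_space_mono:
  fixes Q X Y :: "('v set \<Rightarrow> 'k::field) set"
  assumes Q: "lin_closed Q" and X: "lin_closed X" and Y: "lin_closed Y" "Y \<subseteq> carrier (chain_space K k)"
    and "X \<subseteq> Y" "finite K"
  shows "vectorspace.dim coeff_field (coset_space Q X) \<le> vectorspace.dim coeff_field (coset_space Q Y)"
proof -
  interpret Y: linear_map coeff_field "chain_subspace Y" "coset_space Q Y" "coset Q"
    by (rule linear_map_coset[OF Q Y(1)])
  have "Q \<in> coset Q ` X" using coset_zero lin_closedD(1)[OF X] by (metis image_eqI)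
  then have "subspace coeff_field (coset Q ` X) (coset_space Q Y)"
    unfolding subspace_def submodule_def
    using Y.W.vectorspace_axioms \<open>X \<subseteq> Y\<close> lin_closedD[OF X]
    by (auto simp: vectorspace_def coset_space_simps[OF Q])
  from Y.W.subspace_fin_dim(2)[OF this dim_coset_space(1)[OF Q Y \<open>finite K\<close>]]
  show ?thesis by (simp add: coset_space_simps[OF Q])
qed

text \<open>\<open>X / (X \<inter> Q)\<close> embeds in \<open>Y / (Y \<inter> Q)\<close>; the
  inequality of dimensions is rearranged to avoid subtraction.\<close>

lemma chain_dim_modular:
  fixes Q X Y :: "('v set \<Rightarrow> 'k::field) set"
  assumes "lin_closed Q" "lin_closed X" "lin_closed Y" "Y \<subseteq> carrier (chain_space K k)" "X \<subseteq> Y" "finite K"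
  shows "chain_dim X + chain_dim (Y \<inter> Q) \<le> chain_dim Y + chain_dim (X \<inter> Q)"
  using dim_coset_space_mono[OF assms] dim_coset_space(2)[OF assms(1,3,4,6)]
    dim_coset_space(2)[OF assms(1,2) order_trans[OF assms(5,4)] assms(6)] by linarith

section \<open>Ranks of the maps induced by inclusions\<close>

lemma cycles_mono:
  assumes "finite_simplicial_complex A" "finite_simplicial_complex B" "A \<subseteq> B"
  shows "cycles r A k \<subseteq> cycles r B k"
proof
  fix c assume "c \<in> cycles r A k"
  then show "c \<in> cycles r B k"
    using chain_space_mono[OF assms(3), of k] boundary_chain_subcomplex[OF assms, of c k r]
    by (auto simp: cycles_def)
qed

lemma boundaries_mono:
  assumes "finite_simplicial_complex A" "finite_simplicial_complex B" "A \<subseteq> B"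
  shows "boundaries r A k \<subseteq> boundaries r B k"
  unfolding boundaries_def
proof
  fix y assume "y \<in> boundary r A ` carrier (chain_space A (k + 1))"
  then obtain c where c: "c \<in> carrier (chain_space A (k + 1))" "y = boundary r A c" by blast
  then have "y = boundary r B c" using boundary_chain_subcomplex[OF assms c(1)] by simp
  then show "y \<in> boundary r B ` carrier (chain_space B (k + 1))"
    using c(1) chain_space_mono[OF assms(3)] by blast
qed

lemma cycles_subset: "cycles r A k \<subseteq> carrier (chain_space A k)"
  by (auto simp: cycles_def)

text \<open>For \<open>A \<subseteq> B\<close> this is the rank of the map in homology induced by
  the inclusion. The type argument fixes the coefficient field, which no other argument
  determines.\<close>

definition homology_rank :: "'k::field itself \<Rightarrow> 'v rel \<Rightarrow> int \<Rightarrow> 'v set set \<Rightarrow> 'v set set \<Rightarrow> nat"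
  where "homology_rank _ r k A B = vectorspace.dim coeff_field
    (coset_space (boundaries r B k :: ('v set \<Rightarrow> 'k) set) (cycles r A k))"

text \<open>Enlarging the boundaries turns the coset of a cycle into its coset modulo the larger
  space. The equality is one of records, so that the dimension in \<open>rank_fun\<close> can be
  rewritten directly.\<close>

lemma homology_image:
  assumes "finite_simplicial_complex A" "finite_simplicial_complex B" "A \<subseteq> B"
  shows "(homology r B k)\<lparr>carrier := inclusion_map r B k ` carrier (homology r A k)\<rparr> =
    coset_space (boundaries r B k) (cycles r A k :: ('v set \<Rightarrow> 'k::field) set)"
proof -
  let ?P = "boundaries r A k :: ('v set \<Rightarrow> 'k) set" and ?Q = "boundaries r B k :: ('v set \<Rightarrow> 'k) set"
  have PQ: "?P \<subseteq> ?Q" by (rule boundaries_mono[OF assms])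
  have "carrier (homology r A k) = coset ?P ` cycles r A k"
    by (auto simp: homology_def quotient_space_def chain_space_update A_RCOSETS_def RCOSETS_def
        coset_def r_coset_def)
  moreover have "inclusion_map r B k (coset ?P z) = coset ?Q z" for z
  proof -
    have "coset ?Q y = coset ?Q z" if "y \<in> coset ?P z" for y
      using that PQ by (auto simp: coset_eq_iff[OF lin_closed_boundaries] mem_coset)
    moreover have "z \<in> coset ?P z"
      using lin_closedD(1)[OF lin_closed_boundaries] by (auto simp: mem_coset)
    moreover have "inclusion_map r B k (coset ?P z) = (\<Union>y\<in>coset ?P z. coset ?Q y)"
      by (simp add: inclusion_map_def r_coset_chain_space)
    ultimately show ?thesis by blast
  qed
  ultimately have "inclusion_map r B k ` carrier (homology r A k) = coset ?Q ` cycles r A k"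
    by (simp add: image_image)
  then show ?thesis
    by (simp add: homology_def coset_space_def quotient_space_def chain_space_update r_coset_chain
        set_add_def add_chain_subspace) (simp add: set_mult_def fun_eq_iff)
qed

lemma homology_rank_formula:
  fixes r :: "'v rel"
  assumes "finite_simplicial_complex A"
  shows "homology_rank TYPE('k::field) r k A B +
    chain_dim (cycles r A k \<inter> boundaries r B k :: ('v set \<Rightarrow> 'k) set) =
    chain_dim (cycles r A k :: ('v set \<Rightarrow> 'k) set)"
  unfolding homology_rank_def
  by (rule dim_coset_space(2)[OF lin_closed_boundaries lin_closed_cycles cycles_subset complex_finite[OF assms]])

lemma homology_rank_mono:
  assumes "finite_simplicial_complex A" "finite_simplicial_complex A'" "A \<subseteq> A'"
  shows "homology_rank TYPE('k::field) r k A B \<le> homology_rank TYPE('k) r k A' B"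
  unfolding homology_rank_def
  by (rule dim_coset_space_mono[OF lin_closed_boundaries lin_closed_cycles lin_closed_cycles
        cycles_subset cycles_mono[OF assms] complex_finite[OF assms(2)]])

text \<open>By \<open>homology_rank_formula\<close> the dimensions of the cycle spaces cancel. What
  remains is \<open>chain_dim_modular\<close> for the cycles of \<open>A\<close> and
  \<open>A'\<close> that bound in \<open>B'\<close>, taken modulo the boundaries of
  \<open>B\<close>.\<close>

lemma homology_rank_rectangle:
  fixes r :: "'v rel"
  assumes A: "finite_simplicial_complex A" "finite_simplicial_complex A'" "A \<subseteq> A'"
    and B: "finite_simplicial_complex B" "finite_simplicial_complex B'" "B \<subseteq> B'"
  shows "homology_rank TYPE('k::field) r k A B + homology_rank TYPE('k) r k A' B' \<le>
    homology_rank TYPE('k) r k A' B + homology_rank TYPE('k) r k A B'"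
proof -
  let ?Z = "\<lambda>A. cycles r A k :: ('v set \<Rightarrow> 'k) set" and ?Q = "\<lambda>B. boundaries r B k :: ('v set \<Rightarrow> 'k) set"
  have "chain_dim (?Z A \<inter> ?Q B') + chain_dim ((?Z A' \<inter> ?Q B') \<inter> ?Q B) \<le>
    chain_dim (?Z A' \<inter> ?Q B') + chain_dim ((?Z A \<inter> ?Q B') \<inter> ?Q B)"
  proof (rule chain_dim_modular)
    show "?Z A' \<inter> ?Q B' \<subseteq> carrier (chain_space A' k)" using cycles_subset[of r A' k] by blast
    show "?Z A \<inter> ?Q B' \<subseteq> ?Z A' \<inter> ?Q B'" using cycles_mono[OF A, of r k] by blast
  qed (intro lin_closed_Int lin_closed_cycles lin_closed_boundaries complex_finite A)+
  moreover have "(?Z X \<inter> ?Q B') \<inter> ?Q B = ?Z X \<inter> ?Q B" for X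
    using boundaries_mono[OF B] by blast
  ultimately show ?thesis
    using homology_rank_formula[where 'k = 'k and r = r and k = k, OF A(1), of B]
      homology_rank_formula[where 'k = 'k and r = r and k = k, OF A(1), of B']
      homology_rank_formula[where 'k = 'k and r = r and k = k, OF A(2), of B]
      homology_rank_formula[where 'k = 'k and r = r and k = k, OF A(2), of B'] by simp
qed

section \<open>Invariance of ranks when no critical simplex is added\<close>

locale gradient_complexes =
  fixes K :: "'v set set" and r :: "'v rel" and V :: "('v set \<times> 'v set) set"
  assumes K: "finite_simplicial_complex K" and lin: "linear_order_on (\<Union>K) r"
    and V: "gradient_vector_field K V"
begin

text \<open>No pair is split, so the difference of two nested complexes of this kind consists of
  whole pairs and critical simplices.\<close>

definition V_closed :: "'v set set \<Rightarrow> bool"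
  where "V_closed A \<longleftrightarrow> finite_simplicial_complex A \<and> A \<subseteq> K \<and> (\<forall>(\<sigma>, \<tau>)\<in>V. \<sigma> \<in> A \<longleftrightarrow> \<tau> \<in> A)"

lemma relative_cycle:
  fixes c :: "'v set \<Rightarrow> 'k::field"
  assumes A: "V_closed A" and B: "V_closed B" and AB: "A \<subseteq> B" "(B - A) \<inter> critical_simplices K V = {}"
    and c: "c \<in> carrier (chain_space B j)" "\<And>\<sigma>. boundary r B c \<sigma> \<noteq> 0 \<Longrightarrow> \<sigma> \<in> A"
  obtains c' b where "c' \<in> carrier (chain_space A j)" "b \<in> carrier (chain_space B (j + 1))"
    "c = (\<lambda>\<sigma>. c' \<sigma> + boundary r B b \<sigma>)" "boundary r A c' = boundary r B c"
proof -
  have X: "\<Union>B \<subseteq> \<Union>K" and fin: "finite_simplicial_complex A" "finite_simplicial_complex B"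
    using A B by (auto simp: V_closed_def)
  have crit: "\<forall>\<sigma>\<in>B - A. \<exists>(\<alpha>, \<beta>)\<in>V. \<sigma> = \<alpha> \<or> \<sigma> = \<beta>"
  proof
    fix \<sigma> assume "\<sigma> \<in> B - A"
    then have "\<sigma> \<in> K" "\<sigma> \<notin> critical_simplices K V"
      using AB(2) B by (auto simp: V_closed_def)
    then show "\<exists>(\<alpha>, \<beta>)\<in>V. \<sigma> = \<alpha> \<or> \<sigma> = \<beta>"
      unfolding critical_simplices_def by fast
  qed
  obtain c' b where c': "c' \<in> carrier (chain_space A j)" "b \<in> carrier (chain_space B (j + 1))"
    "c = (\<lambda>\<sigma>. c' \<sigma> + boundary r B b \<sigma>)"
    using relative_homology_trivial[OF fin AB(1) lin X V _ _ crit c] A B unfolding V_closed_def by blast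
  moreover have "boundary r A c' = boundary r B c"
    using c'(3) boundary_boundary[OF fin(2) lin X, of b] boundary_chain_subcomplex[OF fin AB(1) c'(1), of r]
    by (simp add: boundary_add)
  ultimately show ?thesis using that by blast
qed

text \<open>A cycle of \<open>A'\<close> equals a cycle of \<open>A\<close> plus a boundary in
  \<open>A'\<close>, which is also a boundary in \<open>B\<close>. Both cycle spaces thus have the
  same classes modulo the boundaries of \<open>B\<close>.\<close>

lemma homology_rank_cong_source:
  assumes A: "V_closed A" and A': "V_closed A'" and AA': "A \<subseteq> A'" "(A' - A) \<inter> critical_simplices K V = {}"
    and B: "finite_simplicial_complex B" "A' \<subseteq> B"
  shows "homology_rank TYPE('k::field) r k A B = homology_rank TYPE('k) r k A' B"
proof -
  let ?Q = "boundaries r B k :: ('v set \<Rightarrow> 'k) set"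
  have fin: "finite_simplicial_complex A" "finite_simplicial_complex A'"
    using A A' by (auto simp: V_closed_def)
  have "coset ?Q z \<in> coset ?Q ` cycles r A k" if z: "z \<in> cycles r A' k" for z
  proof -
    have "z \<in> carrier (chain_space A' k)" and bz: "boundary r A' z = (\<lambda>_. 0)"
      using z by (auto simp: cycles_def)
    then obtain c b where c: "c \<in> carrier (chain_space A k)" "b \<in> carrier (chain_space A' (k + 1))"
      "z = (\<lambda>\<sigma>. c \<sigma> + boundary r A' b \<sigma>)" "boundary r A c = boundary r A' z"
      using relative_cycle[OF A A' AA', of z k] by auto
    have "c \<in> cycles r A k" using c(1,4) bz by (simp add: cycles_def)
    moreover have "boundary r A' b \<in> ?Q"
      using boundaries_mono[OF fin(2) B, of r k] c(2) by (auto simp: boundaries_def)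
    then have "coset ?Q z = coset ?Q c"
      unfolding coset_eq_iff[OF lin_closed_boundaries] c(3) by simp
    ultimately show ?thesis by blast
  qed
  then have "coset ?Q ` cycles r A k = coset ?Q ` cycles r A' k"
    using cycles_mono[OF fin AA'(1), of r k] by blast
  then show ?thesis by (simp add: homology_rank_def coset_space_def)
qed

text \<open>If a cycle of \<open>A\<close> is the boundary of a chain \<open>c\<close> of
  \<open>B'\<close>, then \<open>c\<close> is a relative cycle modulo \<open>B\<close> and can be
  replaced by a chain of \<open>B\<close> with the same boundary. So the same cycles of
  \<open>A\<close> bound in \<open>B\<close> and in \<open>B'\<close>.\<close>

lemma homology_rank_cong_target:
  assumes B: "V_closed B" and B': "V_closed B'" and BB': "B \<subseteq> B'" "(B' - B) \<inter> critical_simplices K V = {}"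
    and A: "finite_simplicial_complex A" "A \<subseteq> B"
  shows "homology_rank TYPE('k::field) r k A B = homology_rank TYPE('k) r k A B'"
proof -
  have fin: "finite_simplicial_complex B" "finite_simplicial_complex B'"
    using B B' by (auto simp: V_closed_def)
  have "z \<in> boundaries r B k"
    if z: "z \<in> cycles r A k" "z \<in> boundaries r B' k" for z :: "'v set \<Rightarrow> 'k"
  proof -
    obtain c where c: "c \<in> carrier (chain_space B' (k + 1))" "z = boundary r B' c"
      using z(2) by (auto simp: boundaries_def)
    have "\<sigma> \<in> B" if "boundary r B' c \<sigma> \<noteq> 0" for \<sigma>
      using z(1) c(2) that A(2) by (auto simp: cycles_def mem_chain_space)
    then obtain c' b where "c' \<in> carrier (chain_space B (k + 1))" "boundary r B c' = boundary r B' c"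
      using relative_cycle[OF B B' BB' c(1)] by blast
    then show ?thesis unfolding boundaries_def c(2) by (metis image_eqI)
  qed
  then have "cycles r A k \<inter> boundaries r B k = (cycles r A k \<inter> boundaries r B' k :: ('v set \<Rightarrow> 'k) set)"
    using boundaries_mono[OF fin BB'(1), of r k] by blast
  then show ?thesis
    using homology_rank_formula[where 'k = 'k and r = r and k = k, OF A(1), of B]
      homology_rank_formula[where 'k = 'k and r = r and k = k, OF A(1), of B'] by simp
qed

end

section \<open>Diagrams of rank functions with finitely many jumps\<close>

text \<open>For \<open>a \<le> b \<le> c \<le> d\<close> this counts the bars born between
  \<open>a\<close> and \<open>b\<close> that die between \<open>c\<close> and
  \<open>d\<close>.\<close>

definition rect_rank :: "(real, 'k::field, 'a) pers_module \<Rightarrow> real \<Rightarrow> real \<Rightarrow> real \<Rightarrow> real \<Rightarrow> int"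
  where "rect_rank W a b c d = rank_fun W b c - rank_fun W a c - rank_fun W b d + rank_fun W a d"

lemma finite_gap:
  fixes S :: "real set"
  assumes "finite S"
  obtains e where "e > 0" "\<forall>x\<in>S. x \<noteq> a \<longrightarrow> e < \<bar>x - a\<bar>"
proof -
  obtain d where "d > 0" "\<forall>x\<in>S. x \<noteq> a \<longrightarrow> d \<le> dist a x"
    using finite_set_avoid[OF assms] by blast
  then show ?thesis using that[of "d / 2"] by (force simp: dist_real_def abs_minus_commute)
qed

text \<open>\<open>D\<close> labels the possible jumps and \<open>p\<close> places them. The two are
  separated because two lines share the labels but not the positions, and because several labels may
  have the same position.\<close>

locale finitely_stepped =
  fixes W :: "(real, 'k::field, 'a) pers_module" and D :: "'c set" and p :: "'c \<Rightarrow> real"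
  assumes fin: "finite D"
    and rank_cong: "\<And>s t s' t'. s \<le> t \<Longrightarrow> s' \<le> t' \<Longrightarrow> {c\<in>D. p c \<le> s} = {c\<in>D. p c \<le> s'} \<Longrightarrow>
      {c\<in>D. p c \<le> t} = {c\<in>D. p c \<le> t'} \<Longrightarrow> rank_fun W s t = rank_fun W s' t'"
    and rank_mono: "\<And>s s' t. s \<le> s' \<Longrightarrow> s' \<le> t \<Longrightarrow> rank_fun W s t \<le> rank_fun W s' t"
    and rect_nonneg: "\<And>a b c d. a \<le> b \<Longrightarrow> b \<le> c \<Longrightarrow> c \<le> d \<Longrightarrow> 0 \<le> rect_rank W a b c d"
begin

text \<open>The strict inequality keeps \<open>s + e\<close> and \<open>s - e\<close> themselves off
  the other jumps, so the level sets there are those at \<open>s\<close> and just before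
  \<open>s\<close>.\<close>

definition isolating :: "real \<Rightarrow> real \<Rightarrow> bool"
  where "isolating e s \<longleftrightarrow> e > 0 \<and> (\<forall>x\<in>D. p x \<noteq> s \<longrightarrow> e < \<bar>p x - s\<bar>)"

lemma isolating_exists: obtains e where "isolating e s"
  using finite_gap[of "p ` D" s] fin that by (auto simp: isolating_def)

lemma isolating_mono: "isolating e s \<Longrightarrow> 0 < e' \<Longrightarrow> e' \<le> e \<Longrightarrow> isolating e' s"
  unfolding isolating_def by force

lemma level_upper: "isolating e s \<Longrightarrow> {x\<in>D. p x \<le> s + e} = {x\<in>D. p x \<le> s}"
  unfolding isolating_def by force

lemma level_lower: "isolating e s \<Longrightarrow> {x\<in>D. p x \<le> s - e} = {x\<in>D. p x < s}"
  unfolding isolating_def by force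

text \<open>The outer rectangle consists of the inner one and four further non-negative ones: two
  with the full range of deaths, and two with the inner range of births.\<close>

lemma rect_rank_mono:
  assumes "a2 \<le> a1" "a1 \<le> b1" "b1 \<le> b2" "b2 \<le> c2" "c2 \<le> c1" "c1 \<le> d1" "d1 \<le> d2"
  shows "rect_rank W a1 b1 c1 d1 \<le> rect_rank W a2 b2 c2 d2"
  using rect_nonneg[of a2 a1 c2 d2] rect_nonneg[of b1 b2 c2 d2] rect_nonneg[of a1 b1 c2 c1]
    rect_nonneg[of a1 b1 d1 d2] assms
  by (simp add: rect_rank_def)

lemma multiplicity_fin_eq:
  assumes e: "isolating e s" "isolating e t" "s + e < t - e"
  shows "multiplicity_fin W s t = rect_rank W (s - e) (s + e) (t - e) (t + e)"
  unfolding multiplicity_fin_def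
proof (rule Least_equality)
  show "\<exists>e'>0. s + e' < t - e' \<and> rect_rank W (s - e) (s + e) (t - e) (t + e) =
    rank_fun W (s + e') (t - e') - rank_fun W (s - e') (t - e')
      - rank_fun W (s + e') (t + e') + rank_fun W (s - e') (t + e')"
    using e by (intro exI[of _ e]) (auto simp: isolating_def rect_rank_def)
next
  fix n assume "\<exists>e'>0. s + e' < t - e' \<and> n = rank_fun W (s + e') (t - e') - rank_fun W (s - e') (t - e')
      - rank_fun W (s + e') (t + e') + rank_fun W (s - e') (t + e')"
  then obtain e' where e': "e' > 0" "s + e' < t - e'"
    and n: "n = rect_rank W (s - e') (s + e') (t - e') (t + e')"
    by (auto simp: rect_rank_def)
  have "e > 0" using e by (simp add: isolating_def)
  show "rect_rank W (s - e) (s + e) (t - e) (t + e) \<le> n"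
  \<comment> \<open>A larger \<open>e'\<close> gives a rectangle containing the one for
    \<open>e\<close>; a smaller \<open>e'\<close> is isolating too and meets the same level
    sets.\<close>
  proof (cases "e \<le> e'")
    case True
    then show ?thesis unfolding n using e' \<open>e > 0\<close> e(3) by (intro rect_rank_mono) auto
  next
    case False
    then have "isolating e' s" "isolating e' t" using isolating_mono e e' by force+
    then have "rect_rank W (s - e) (s + e) (t - e) (t + e) = n"
      unfolding n rect_rank_def using e e' \<open>e > 0\<close>
      by (intro arg_cong2[where f = "(+)"] arg_cong2[where f = "(-)"] rank_cong)
        (auto simp: level_upper level_lower)
    then show ?thesis by simp
  qed
qed

lemma multiplicity_inf_eq:
  assumes e: "isolating e s" and t0: "s + e \<le> t0" "\<And>x. x \<in> D \<Longrightarrow> p x \<le> t0"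
  shows "multiplicity_inf W s = rank_fun W (s + e) t0 - rank_fun W (s - e) t0"
  unfolding multiplicity_inf_def
proof (rule Least_equality)
  show "\<exists>e'>0. \<exists>t\<ge>s + e'. rank_fun W (s + e) t0 - rank_fun W (s - e) t0 = rank_fun W (s + e') t - rank_fun W (s - e') t"
    using e t0 by (auto simp: isolating_def)
next
  fix n assume "\<exists>e'>0. \<exists>t\<ge>s + e'. n = rank_fun W (s + e') t - rank_fun W (s - e') t"
  then obtain e' t where e': "e' > 0" "s + e' \<le> t" and n: "n = rank_fun W (s + e') t - rank_fun W (s - e') t"
    by auto
  have "e > 0" using e by (simp add: isolating_def)
  \<comment> \<open>The competing \<open>t\<close> need not lie beyond all jumps. Raising it to
    \<open>t1\<close> can only lower the difference, and beyond \<open>t0\<close> nothing changes,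
    so both differences are compared at \<open>t1\<close>.\<close>
  define t1 where "t1 = max t t0"
  have n1: "rank_fun W (s + e') t1 - rank_fun W (s - e') t1 \<le> n"
    using rect_nonneg[of "s - e'" "s + e'" t t1] e' by (simp add: n t1_def rect_rank_def)
  have top: "{x\<in>D. p x \<le> t0} = {x\<in>D. p x \<le> t1}" using t0(2) by (force simp: t1_def)
  have eq: "rank_fun W (s + e) t0 = rank_fun W (s + e) t1" "rank_fun W (s - e) t0 = rank_fun W (s - e) t1"
    using t0(1) \<open>e > 0\<close> top by (intro rank_cong; simp add: t1_def)+
  show "rank_fun W (s + e) t0 - rank_fun W (s - e) t0 \<le> n"
  proof (cases "e \<le> e'")
    case True
    have "s + e' \<le> t1" "s - e \<le> t1" using e' t0(1) \<open>e > 0\<close> by (auto simp: t1_def)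
    then show ?thesis
      using True n1 eq rank_mono[of "s + e" "s + e'" t1] rank_mono[of "s - e'" "s - e" t1] by simp
  next
    case False
    then have "isolating e' s" using isolating_mono e e' by force
    then have "rank_fun W (s + e) t1 = rank_fun W (s + e') t1" "rank_fun W (s - e) t1 = rank_fun W (s - e') t1"
      using e e' t0(1) \<open>e > 0\<close> by (intro rank_cong; simp add: t1_def level_upper level_lower)+
    then show ?thesis using n1 eq by simp
  qed
qed

lemma isolating_common:
  assumes "s < t"
  obtains e where "isolating e s" "isolating e t" "s + e < t - e"
proof -
  obtain e1 e2 where e: "isolating e1 s" "isolating e2 t" using isolating_exists by metis
  \<comment> \<open>One third of the distance leaves a gap between \<open>s + e\<close> and
    \<open>t - e\<close>.\<close>
  define e where "e = min (min e1 e2) ((t - s) / 3)"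
  have "e > 0" using e assms by (simp add: e_def isolating_def)
  moreover have "e \<le> e1" "e \<le> e2" by (simp_all add: e_def)
  moreover have "e \<le> (t - s) / 3" unfolding e_def by (rule min.cobounded2)
  ultimately show ?thesis using that[of e] isolating_mono e assms by (auto simp: field_simps)
qed

text \<open>Away from the jumps the levels just before and just after a parameter agree, so the
  differences that define the multiplicity cancel.\<close>

lemma dgm_support:
  assumes "dgm W (s, t) > 0"
  obtains c where "c \<in> D" "s = p c" "t = \<infinity> \<or> (\<exists>d\<in>D. t = ereal (p d))"
proof -
  have st: "ereal s < t" using assms by (auto simp: dgm_def split: if_splits)
  have no_level: "{x\<in>D. p x \<le> u} = {x\<in>D. p x < u}" if "u \<notin> p ` D" for u
    using that by force
  show ?thesis
  proof (cases "t = \<infinity>")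
    case True
    obtain e where e: "isolating e s" using isolating_exists .
    define t0 where "t0 = Max (insert (s + e) (p ` D))"
    have t0: "s + e \<le> t0" "\<And>x. x \<in> D \<Longrightarrow> p x \<le> t0" using fin by (auto simp: t0_def)
    have "multiplicity_inf W s > 0" using assms st True by (simp add: dgm_def)
    then have ne: "rank_fun W (s + e) t0 \<noteq> rank_fun W (s - e) t0"
      using multiplicity_inf_eq[OF e t0] by simp
    have "s \<in> p ` D"
    proof (rule ccontr)
      assume "s \<notin> p ` D"
      then have "rank_fun W (s + e) t0 = rank_fun W (s - e) t0"
        using t0(1) e by (intro rank_cong) (auto simp: level_upper level_lower no_level isolating_def)
      with ne show False by simp
    qed
    then show ?thesis using that True by blast
  next
    case False
    then obtain b where t: "t = ereal b" and "s < b" using st by (cases t) auto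
    from isolating_common[OF \<open>s < b\<close>] obtain e
      where e: "isolating e s" "isolating e b" "s + e < b - e" .
    have "e > 0" using e by (simp add: isolating_def)
    have "multiplicity_fin W s b > 0" using assms st False by (simp add: dgm_def t)
    then have ne: "rect_rank W (s - e) (s + e) (b - e) (b + e) \<noteq> 0"
      using multiplicity_fin_eq[OF e] by simp
    have "s \<in> p ` D"
    proof (rule ccontr)
      assume "s \<notin> p ` D"
      then have "rank_fun W (s + e) v = rank_fun W (s - e) v" if "v \<ge> s + e" for v
        using that e \<open>e > 0\<close> by (intro rank_cong) (auto simp: level_upper level_lower no_level)
      with ne show False using e(3) \<open>e > 0\<close> by (simp add: rect_rank_def)
    qed
    moreover have "b \<in> p ` D"
    proof (rule ccontr)
      assume "b \<notin> p ` D"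
      then have "rank_fun W v (b - e) = rank_fun W v (b + e)" if "v \<le> b - e" for v
        using that e \<open>e > 0\<close> by (intro rank_cong) (auto simp: level_upper level_lower no_level)
      with ne show False using e(3) \<open>e > 0\<close> by (simp add: rect_rank_def)
    qed
    ultimately show ?thesis using that t by blast
  qed
qed

end

section \<open>Two rank functions whose jumps occur in the same order\<close>

locale order_equivalent_steps = L: finitely_stepped W D p + L': finitely_stepped W' D p'
  for W :: "(real, 'k::field, 'a) pers_module" and W' :: "(real, 'k, 'a) pers_module"
    and D :: "'c set" and p p' :: "'c \<Rightarrow> real" +
  assumes order_iff: "\<And>c d. c \<in> D \<Longrightarrow> d \<in> D \<Longrightarrow> p c \<le> p d \<longleftrightarrow> p' c \<le> p' d"
    and rank_eq: "\<And>s t s' t'. s \<le> t \<Longrightarrow> s' \<le> t' \<Longrightarrow> {c\<in>D. p c \<le> s} = {c\<in>D. p' c \<le> s'} \<Longrightarrow>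
      {c\<in>D. p c \<le> t} = {c\<in>D. p' c \<le> t'} \<Longrightarrow> rank_fun W s t = rank_fun W' s' t'"
begin

lemma less_iff: "c \<in> D \<Longrightarrow> d \<in> D \<Longrightarrow> p c < p d \<longleftrightarrow> p' c < p' d"
  using order_iff[of d c] by linarith

lemma eq_iff: "c \<in> D \<Longrightarrow> d \<in> D \<Longrightarrow> p c = p d \<longleftrightarrow> p' c = p' d"
  using order_iff[of d c] order_iff[of c d] by linarith

lemma levels:
  assumes "c \<in> D"
  shows "{x\<in>D. p x \<le> p c} = {x\<in>D. p' x \<le> p' c}" "{x\<in>D. p x < p c} = {x\<in>D. p' x < p' c}"
  using assms order_iff less_iff by auto

lemma dgm_eq_fin:
  assumes "c \<in> D" "d \<in> D"
  shows "dgm W (p c, ereal (p d)) = dgm W' (p' c, ereal (p' d))"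
proof (cases "p c < p d")
  case True
  then have True': "p' c < p' d" using less_iff assms by simp
  obtain e where e: "L.isolating e (p c)" "L.isolating e (p d)" "p c + e < p d - e"
    using L.isolating_common[OF True] .
  obtain e' where e': "L'.isolating e' (p' c)" "L'.isolating e' (p' d)" "p' c + e' < p' d - e'"
    using L'.isolating_common[OF True'] .
  have "e > 0" "e' > 0" using e e' by (simp_all add: L.isolating_def L'.isolating_def)
  note lv = levels[OF assms(1)] levels[OF assms(2)] L.level_upper[OF e(1)] L.level_upper[OF e(2)]
    L.level_lower[OF e(1)] L.level_lower[OF e(2)] L'.level_upper[OF e'(1)] L'.level_upper[OF e'(2)]
    L'.level_lower[OF e'(1)] L'.level_lower[OF e'(2)]
  have "rect_rank W (p c - e) (p c + e) (p d - e) (p d + e) =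
    rect_rank W' (p' c - e') (p' c + e') (p' d - e') (p' d + e')"
    unfolding rect_rank_def using e e' \<open>e > 0\<close> \<open>e' > 0\<close>
    by (intro arg_cong2[where f = "(+)"] arg_cong2[where f = "(-)"] rank_eq) (simp_all add: lv)
  then show ?thesis
    using L.multiplicity_fin_eq[OF e] L'.multiplicity_fin_eq[OF e'] True True' by (simp add: dgm_def)
next
  case False
  then show ?thesis using less_iff assms by (simp add: dgm_def)
qed

lemma dgm_eq_inf:
  assumes "c \<in> D"
  shows "dgm W (p c, \<infinity>) = dgm W' (p' c, \<infinity>)"
proof -
  obtain e where e: "L.isolating e (p c)" using L.isolating_exists .
  obtain e' where e': "L'.isolating e' (p' c)" using L'.isolating_exists .
  have pos: "e > 0" "e' > 0" using e e' by (simp_all add: L.isolating_def L'.isolating_def)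
  define t where "t = Max (insert (p c + e) (p ` D))"
  define t' where "t' = Max (insert (p' c + e') (p' ` D))"
  have t: "p c + e \<le> t" "\<And>x. x \<in> D \<Longrightarrow> p x \<le> t" using L.fin by (auto simp: t_def)
  have t': "p' c + e' \<le> t'" "\<And>x. x \<in> D \<Longrightarrow> p' x \<le> t'" using L.fin by (auto simp: t'_def)
  have top: "{x\<in>D. p x \<le> t} = {x\<in>D. p' x \<le> t'}" using t(2) t'(2) by auto
  have "rank_fun W (p c + e) t = rank_fun W' (p' c + e') t'"
    using t(1) t'(1) top levels(1)[OF assms]
    by (intro rank_eq) (simp_all add: L.level_upper[OF e] L'.level_upper[OF e'])
  moreover have "rank_fun W (p c - e) t = rank_fun W' (p' c - e') t'"
    using t(1) t'(1) pos top levels(2)[OF assms]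
    by (intro rank_eq) (simp_all add: L.level_lower[OF e] L'.level_lower[OF e'])
  ultimately show ?thesis
    using L.multiplicity_inf_eq[OF e t] L'.multiplicity_inf_eq[OF e' t'] by (simp add: dgm_def)
qed

text \<open>The map \<open>\<phi>\<close> is prescribed only at the jumps, which by
  \<open>dgm_support\<close> contain all finite coordinates of the diagram. There
  \<open>eq_iff\<close> makes it injective, and the same support argument for \<open>W'\<close>
  makes it onto.\<close>

lemma dgm_multi_bijection:
  assumes \<phi>: "\<And>c. c \<in> D \<Longrightarrow> \<phi> (p c) = p' c"
  shows "multi_bijection (dgm W) (dgm W')
    (\<lambda>(s, t). (\<phi> s, if t = \<infinity> then \<infinity> else ereal (\<phi> (real_of_ereal t))))" (is "multi_bijection _ _ ?\<gamma>")
proof -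
  have mult: "dgm W' (?\<gamma> q) = dgm W q" if q: "dgm W q > 0" for q
  proof -
    obtain s t where st: "q = (s, t)" by (cases q)
    obtain c where "c \<in> D" "s = p c" "t = \<infinity> \<or> (\<exists>d\<in>D. t = ereal (p d))"
      using L.dgm_support q unfolding st by blast
    then show ?thesis using dgm_eq_fin dgm_eq_inf \<phi> by (auto simp: st)
  qed
  have inj: "inj_on ?\<gamma> {q. dgm W q > 0}"
  proof (rule inj_onI)
    fix q q' assume q: "q \<in> {q. dgm W q > 0}" "q' \<in> {q. dgm W q > 0}" "?\<gamma> q = ?\<gamma> q'"
    obtain s t s' t' where st: "q = (s, t)" "q' = (s', t')" by (cases q, cases q')
    have pos: "dgm W (s, t) > 0" "dgm W (s', t') > 0" using q(1,2) by (simp_all add: st)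
    obtain c where "c \<in> D" "s = p c" "t = \<infinity> \<or> (\<exists>d\<in>D. t = ereal (p d))"
      using L.dgm_support[OF pos(1)] .
    moreover obtain c' where "c' \<in> D" "s' = p c'" "t' = \<infinity> \<or> (\<exists>d\<in>D. t' = ereal (p d))"
      using L.dgm_support[OF pos(2)] .
    ultimately show "q = q'" using q(3) \<phi> eq_iff by (auto simp: st split: if_splits)
  qed
  have onto: "q \<in> ?\<gamma> ` {q. dgm W q > 0}" if q: "dgm W' q > 0" for q
  proof -
    obtain s t where st: "q = (s, t)" by (cases q)
    obtain c where c: "c \<in> D" "s = p' c" and t: "t = \<infinity> \<or> (\<exists>d\<in>D. t = ereal (p' d))"
      using L'.dgm_support q unfolding st by blast
    show ?thesis
    proof (cases "t = \<infinity>")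
      case True
      then show ?thesis
        using q c \<phi> dgm_eq_inf[of c] by (intro image_eqI[of _ _ "(p c, \<infinity>)"]) (auto simp: st)
    next
      case False
      then obtain d where "d \<in> D" "t = ereal (p' d)" using t by auto
      then show ?thesis
        using q c \<phi> dgm_eq_fin[of c d] by (intro image_eqI[of _ _ "(p c, ereal (p d))"]) (auto simp: st)
    qed
  qed
  show ?thesis
    unfolding multi_bijection_def bij_betw_def using mult inj onto by auto
qed

end

section \<open>Pushing points to lines of positive slope\<close>

text \<open>For positive slope, the least parameter at which the line lies above \<open>u\<close>:
  each coordinate gives one lower bound.\<close>

definition line_param :: "real ^ 'n \<Rightarrow> real ^ 'n \<Rightarrow> real ^ 'n \<Rightarrow> real"
  where "line_param m u0 u = Max (range (\<lambda>i. (u $ i - u0 $ i) / m $ i))"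

text \<open>With positive slope each coordinate inequality can be solved for \<open>s\<close>. The
  points below a point of the line thereby become the level sets of
  \<open>finitely_stepped\<close>.\<close>

lemma le_line_iff:
  assumes "strictly_below 0 m"
  shows "u \<le> s *\<^sub>R m + u0 \<longleftrightarrow> line_param m u0 u \<le> s"
proof -
  have "line_param m u0 u \<le> s \<longleftrightarrow> (\<forall>i. (u $ i - u0 $ i) / m $ i \<le> s)"
    unfolding line_param_def by (subst Max_le_iff) auto
  also have "\<dots> \<longleftrightarrow> (\<forall>i. u $ i \<le> s * m $ i + u0 $ i)"
    using assms by (auto simp: strictly_below_def divide_le_eq algebra_simps)
  finally show ?thesis by (simp add: less_eq_vec_def)
qed

lemma line_param_mono:
  assumes "strictly_below 0 m" "u \<le> v"
  shows "line_param m u0 u \<le> line_param m u0 v"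
proof -
  have "v \<le> line_param m u0 v *\<^sub>R m + u0" using le_line_iff[OF assms(1)] by blast
  with assms(2) have "u \<le> line_param m u0 v *\<^sub>R m + u0" by (rule order_trans)
  then show ?thesis using le_line_iff[OF assms(1)] by blast
qed

lemma line_param_attained:
  assumes "strictly_below 0 m"
  obtains i where "(line_param m u0 u *\<^sub>R m + u0) $ i = u $ i"
proof -
  have "line_param m u0 u \<in> range (\<lambda>i. (u $ i - u0 $ i) / m $ i)"
    unfolding line_param_def by (intro Max_in) auto
  then obtain i where "line_param m u0 u = (u $ i - u0 $ i) / m $ i" by auto
  moreover have "m $ i > 0" using assms by (simp add: strictly_below_def)
  ultimately show ?thesis using that[of i] by (simp add: field_simps)
qed

section \<open>The boundary of an orthant and pushes\<close>

lemma frontier_atLeast: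
  fixes u :: "real ^ 'n"
  shows "frontier {u..} = {x. u \<le> x \<and> (\<exists>i. x $ i = u $ i)}"
proof -
  let ?S = "{x. \<forall>i. u $ i < x $ i} :: (real ^ 'n) set"
  have atLeast: "{u..} = (\<Inter>i. {x. u $ i \<le> x $ i})" by (auto simp: less_eq_vec_def)
  have "closed {u..}"
    unfolding atLeast by (intro closed_INT ballI closed_Collect_le continuous_intros)
  moreover have "interior {u..} = ?S"
  proof (rule interior_unique)
    show "?S \<subseteq> {u..}" by (auto simp: less_eq_vec_def less_imp_le)
    have "?S = (\<Inter>i. {x. u $ i < x $ i})" by auto
    then show "open ?S" by (auto intro!: open_INT open_Collect_less continuous_intros)
    fix T assume T: "T \<subseteq> {u..}" "open T"
    show "T \<subseteq> ?S"
    proof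
      fix x assume "x \<in> T"
      then obtain e where e: "e > 0" "ball x e \<subseteq> T" using T(2) open_contains_ball by blast
      have "u $ i < x $ i" for i
      proof -
        \<comment> \<open>Moving half the radius against coordinate \<open>i\<close> stays inside
          \<open>T\<close>, hence above \<open>u\<close>, so the inequality in coordinate
          \<open>i\<close> is strict.\<close>
        have "x - (e / 2) *\<^sub>R axis i 1 \<in> ball x e" using e(1) by (simp add: dist_norm)
        then have "u \<le> x - (e / 2) *\<^sub>R axis i 1" using e(2) T(1) by blast
        then have "u $ i \<le> (x - (e / 2) *\<^sub>R axis i 1) $ i" unfolding less_eq_vec_def by blast
        then show ?thesis using e(1) by simp
      qed
      then show "x \<in> ?S" by simp
    qed
  qed
  ultimately have "frontier {u..} = {x. u \<le> x} - ?S" by (auto simp: frontier_def)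
  moreover have "x \<in> ?S \<longleftrightarrow> \<not> (\<exists>i. x $ i = u $ i)" if "u \<le> x" for x
  proof -
    have "u $ i < x $ i \<longleftrightarrow> x $ i \<noteq> u $ i" for i
      using that by (auto simp: less_eq_vec_def order_less_le)
    then show ?thesis by simp
  qed
  ultimately show ?thesis by blast
qed

text \<open>The maximum defining \<open>line_param\<close> is attained in some coordinate, so its
  point is on the boundary. Conversely, a point of the line that touches \<open>u\<close> in
  coordinate \<open>i\<close> cannot lie beyond it, since \<open>m $ i > 0\<close>.\<close>

lemma push_line:
  assumes "strictly_below 0 m"
  shows "push (line m u0) u = line_param m u0 u *\<^sub>R m + u0"
  unfolding push_def
proof (rule the_equality)
  have "u \<le> line_param m u0 u *\<^sub>R m + u0" using le_line_iff[OF assms] by blast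
  then show "line_param m u0 u *\<^sub>R m + u0 \<in> line m u0 \<inter> frontier {u..}"
    unfolding frontier_atLeast line_def using line_param_attained[OF assms, of u0 u] by blast
next
  fix x assume "x \<in> line m u0 \<inter> frontier {u..}"
  then obtain t i where x: "x = t *\<^sub>R m + u0" and "u \<le> x" and i: "x $ i = u $ i"
    unfolding frontier_atLeast line_def by blast
  then have le: "line_param m u0 u \<le> t" using le_line_iff[OF assms] by blast
  have "u $ i \<le> (line_param m u0 u *\<^sub>R m + u0) $ i"
    using le_line_iff[OF assms, of u "line_param m u0 u" u0] by (simp add: less_eq_vec_def)
  then have "t * m $ i \<le> line_param m u0 u * m $ i" using i by (simp add: x)
  moreover have "m $ i > 0" using assms by (simp add: strictly_below_def)
  ultimately have "t \<le> line_param m u0 u" by simp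
  then show "x = line_param m u0 u *\<^sub>R m + u0" using le by (simp add: x)
qed

text \<open>If \<open>u\<close> is pushed no further than \<open>v\<close> along \<open>L\<close>, then \<open>v\<close> and \<open>sup u v\<close> are pushed to the
  same point of \<open>L\<close>, where they touch a common coordinate; hence so they do on \<open>L'\<close>.\<close>

lemma line_equiv_order:
  fixes D :: "(real ^ 'n) set"
  assumes m: "strictly_below 0 m" "strictly_below 0 m'" and equiv: "line_equiv D (line m u0) (line m' u0')"
    and D: "u \<in> D" "v \<in> D" "sup u v \<in> D" and le: "line_param m u0 u \<le> line_param m u0 v"
  shows "line_param m' u0' u \<le> line_param m' u0' v"
proof -
  let ?w = "sup u v" and ?p = "line_param m u0" and ?p' = "line_param m' u0'"
  have "u \<le> ?p v *\<^sub>R m + u0" "v \<le> ?p v *\<^sub>R m + u0" using le le_line_iff[OF m(1)] by blast+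
  then have "?w \<le> ?p v *\<^sub>R m + u0" by (rule sup_least)
  then have "?p ?w \<le> ?p v" using le_line_iff[OF m(1)] by blast
  moreover have "?p v \<le> ?p ?w" by (rule line_param_mono[OF m(1) sup_ge2])
  ultimately have pw: "?p ?w = ?p v" by simp
  obtain A where A: "?p ?w *\<^sub>R m + u0 \<in> open_face A ?w" "?p' ?w *\<^sub>R m' + u0' \<in> open_face A ?w"
    using equiv D(3) by (auto simp: line_equiv_def push_line m)
  obtain B where B: "B \<noteq> {}" "?p v *\<^sub>R m + u0 \<in> open_face B v" "?p' v *\<^sub>R m' + u0' \<in> open_face B v"
    using equiv D(2) by (auto simp: line_equiv_def push_line m)
  obtain j where j: "j \<in> B" using B(1) by blast
  have xj: "(?p v *\<^sub>R m + u0) $ j = v $ j" "(?p' v *\<^sub>R m' + u0') $ j = v $ j"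
    using B j unfolding open_face_def by blast+
  have "?w \<le> ?p v *\<^sub>R m + u0" using le_line_iff[OF m(1)] pw by simp
  then have "?w $ j \<le> v $ j" using xj(1) unfolding less_eq_vec_def by metis
  moreover have "v $ j \<le> ?w $ j" using sup_ge2[of v u] unfolding less_eq_vec_def by blast
  ultimately have wj: "?w $ j = v $ j" by simp
  have "j \<in> A"
  proof (rule ccontr)
    assume "j \<notin> A"
    then have "?w $ j < (?p v *\<^sub>R m + u0) $ j" using A(1) unfolding open_face_def pw by blast
    then show False using wj xj by simp
  qed
  then have "(?p' ?w *\<^sub>R m' + u0') $ j = ?w $ j" using A(2) unfolding open_face_def by blast
  then have "(?p' ?w *\<^sub>R m' + u0') $ j = (?p' v *\<^sub>R m' + u0') $ j" by (simp only: xj wj)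
  then have "?p' ?w * m' $ j = ?p' v * m' $ j" by simp
  moreover have "m' $ j > 0" using m by (simp add: strictly_below_def)
  ultimately have "?p' ?w = ?p' v" by simp
  moreover have "?p' u \<le> ?p' ?w" by (rule line_param_mono[OF m(2) sup_ge1])
  ultimately show ?thesis by simp
qed

section \<open>Least upper bounds and lower projections\<close>

lemma lub_closure_sup:
  assumes "u \<in> lub_closure C" "v \<in> lub_closure C"
  shows "sup u v \<in> lub_closure C"
proof -
  obtain A B where A: "finite A" "A \<noteq> {}" "A \<subseteq> C" "u = Sup_fin A"
    and B: "finite B" "B \<noteq> {}" "B \<subseteq> C" "v = Sup_fin B"
    using assms by (auto simp: lub_closure_def)
  then have "sup u v = Sup_fin (A \<union> B)" by (simp add: Sup_fin.union)
  then show ?thesis using A B unfolding lub_closure_def by blast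
qed

lemma subset_lub_closure: "C \<subseteq> lub_closure C"
proof
  fix c assume "c \<in> C"
  then have "c = Sup_fin {c} \<and> finite {c} \<and> {c} \<noteq> {} \<and> {c} \<subseteq> C" by simp
  then show "c \<in> lub_closure C" unfolding lub_closure_def by blast
qed

lemma finite_lub_closure: "finite C \<Longrightarrow> finite (lub_closure C)"
proof -
  assume "finite C"
  then have "finite (Sup_fin ` Pow C)" by simp
  moreover have "lub_closure C \<subseteq> Sup_fin ` Pow C" unfolding lub_closure_def by blast
  ultimately show ?thesis by (rule rev_finite_subset)
qed

text \<open>The supremum of the finitely many members of \<open>D\<close> below \<open>x\<close> is
  again such a member, so the \<open>GREATEST\<close> in \<open>lower_proj\<close> is
  attained.\<close>

lemma lower_proj_greatest:
  assumes fin: "finite D" and sup: "\<And>u v. u \<in> D \<Longrightarrow> v \<in> D \<Longrightarrow> sup u v \<in> D" and u: "u \<in> D" "u \<le> x"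
  shows "lower_proj D x \<in> D" "lower_proj D x \<le> x" "u \<le> lower_proj D x"
proof -
  let ?S = "{v\<in>D. v \<le> x}"
  have closed: "Sup_fin T \<in> ?S" if "finite T" "T \<noteq> {}" "T \<subseteq> ?S" for T
    using that by (induction T rule: finite_ne_induct) (auto simp: sup)
  have S: "finite ?S" "?S \<noteq> {}" using fin u by auto
  have mem: "Sup_fin ?S \<in> ?S" using closed[OF S] by simp
  have ub: "v \<le> Sup_fin ?S" if "v \<in> ?S" for v by (rule Sup_fin.coboundedI[OF S(1) that])
  have "lower_proj D x = Sup_fin ?S"
    unfolding lower_proj_def using mem ub by (intro Greatest_equality) auto
  then show "lower_proj D x \<in> D" "lower_proj D x \<le> x" "u \<le> lower_proj D x"
    using mem ub u by auto
qed

text \<open>The projection of the push of \<open>c\<close> may be larger than \<open>c\<close>, but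
  it lies between \<open>c\<close> and the pushed point, so it is pushed to the same place.\<close>

lemma line_param_lower_proj:
  assumes m: "strictly_below 0 m" and D: "finite D" "\<And>u v. u \<in> D \<Longrightarrow> v \<in> D \<Longrightarrow> sup u v \<in> D" and c: "c \<in> D"
  shows "line_param m u0 (lower_proj D (line_param m u0 c *\<^sub>R m + u0)) = line_param m u0 c"
proof -
  let ?p = "line_param m u0"
  have "c \<le> ?p c *\<^sub>R m + u0" using le_line_iff[OF m] by blast
  note g = lower_proj_greatest[OF D c this]
  have "?p (lower_proj D (?p c *\<^sub>R m + u0)) \<le> ?p c" using g(2) le_line_iff[OF m] by blast
  moreover have "?p c \<le> ?p (lower_proj D (?p c *\<^sub>R m + u0))"
    by (rule line_param_mono[OF m g(3)])
  ultimately show ?thesis by simp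
qed

section \<open>Persistent homology of a filtration along a line\<close>

locale consistent_filtration = gradient_complexes K r V
  for K :: "'v set set" and r :: "'v rel" and V :: "('v set \<times> 'v set) set" +
  fixes F :: "real ^ 'n \<Rightarrow> 'v set set"
  assumes filtration: "filtration K F" and tame: "tame_one_critical K F"
    and consistent: "consistent_with V F"
begin

definition crit_lubs :: "(real ^ 'n) set"
  where "crit_lubs = lub_closure (entrance F ` critical_simplices K V)"

lemma entrance_iff: "\<sigma> \<in> K \<Longrightarrow> \<sigma> \<in> F v \<longleftrightarrow> entrance F \<sigma> \<le> v"
proof -
  assume "\<sigma> \<in> K"
  then have "\<exists>!e. \<forall>v. \<sigma> \<in> F v \<longleftrightarrow> e \<le> v" using tame by (simp add: tame_one_critical_def)
  from theI'[OF this] show ?thesis unfolding entrance_def by blast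
qed

lemma complex_F: "finite_simplicial_complex (F u)"
  using filtration by (simp add: filtration_def)

lemma F_mono: "u \<le> v \<Longrightarrow> F u \<subseteq> F v"
  using filtration by (simp add: filtration_def)

lemma V_closed_F: "V_closed (F u)"
proof -
  have "F u \<subseteq> K" using filtration unfolding filtration_def by blast
  moreover have "\<forall>(\<sigma>, \<tau>)\<in>V. \<sigma> \<in> F u \<longleftrightarrow> \<tau> \<in> F u"
    using consistent unfolding consistent_with_def by fast
  ultimately show ?thesis using complex_F unfolding V_closed_def by blast
qed

lemma finite_crit_lubs: "finite crit_lubs"
  using complex_finite[OF K]
  by (auto simp: crit_lubs_def critical_simplices_def intro!: finite_lub_closure)

lemma crit_lubs_sup: "u \<in> crit_lubs \<Longrightarrow> v \<in> crit_lubs \<Longrightarrow> sup u v \<in> crit_lubs"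
  unfolding crit_lubs_def by (rule lub_closure_sup)

text \<open>A critical simplex enters at a member of \<open>crit_lubs\<close>, so a complex that
  gains one also gains a member of \<open>crit_lubs\<close> below its index.\<close>

lemma no_critical_between:
  assumes "{c\<in>crit_lubs. c \<le> u} = {c\<in>crit_lubs. c \<le> w}"
  shows "(F u - F w) \<inter> critical_simplices K V = {}"
proof -
  have "\<sigma> \<in> F w" if \<sigma>: "\<sigma> \<in> F u" "\<sigma> \<in> critical_simplices K V" for \<sigma>
  proof -
    have "\<sigma> \<in> K" using \<sigma>(2) by (simp add: critical_simplices_def)
    moreover have "entrance F \<sigma> \<in> crit_lubs"
      using \<sigma>(2) subset_lub_closure unfolding crit_lubs_def by blast
    ultimately show ?thesis using assms \<sigma>(1) entrance_iff by blast
  qed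
  then show ?thesis by blast
qed

text \<open>The target is raised before the source, because \<open>u\<close> need not lie below
  \<open>w2\<close> and each intermediate map needs its source inside its target.\<close>

lemma homology_rank_shrink:
  assumes le: "w1 \<le> w2" "w1 \<le> u" "w2 \<le> v" "u \<le> v"
    and crit: "{c\<in>crit_lubs. c \<le> u} = {c\<in>crit_lubs. c \<le> w1}" "{c\<in>crit_lubs. c \<le> v} = {c\<in>crit_lubs. c \<le> w2}"
  shows "homology_rank TYPE('k::field) r k (F w1) (F w2) = homology_rank TYPE('k) r k (F u) (F v)"
proof -
  have "homology_rank TYPE('k) r k (F w1) (F w2) = homology_rank TYPE('k) r k (F w1) (F v)"
    by (rule homology_rank_cong_target[OF V_closed_F V_closed_F F_mono[OF le(3)]
          no_critical_between[OF crit(2)] complex_F F_mono[OF le(1)]])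
  also have "\<dots> = homology_rank TYPE('k) r k (F u) (F v)"
    by (rule homology_rank_cong_source[OF V_closed_F V_closed_F F_mono[OF le(2)]
          no_critical_between[OF crit(1)] complex_F F_mono[OF le(4)]])
  finally show ?thesis .
qed

text \<open>Both sides are shrunk to the infima: whatever lies below \<open>u\<close> and
  \<open>u'\<close> lies below \<open>inf u u'\<close>, so no member of \<open>crit_lubs\<close> is
  lost, and \<open>inf_mono\<close> keeps the source below the target.\<close>

lemma homology_rank_eq:
  assumes "u \<le> v" "u' \<le> v'"
    and crit: "{c\<in>crit_lubs. c \<le> u} = {c\<in>crit_lubs. c \<le> u'}" "{c\<in>crit_lubs. c \<le> v} = {c\<in>crit_lubs. c \<le> v'}"
  shows "homology_rank TYPE('k::field) r k (F u) (F v) = homology_rank TYPE('k) r k (F u') (F v')"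
proof -
  have inf: "{c\<in>crit_lubs. c \<le> x} = {c\<in>crit_lubs. c \<le> inf x x'}" "{c\<in>crit_lubs. c \<le> x'} = {c\<in>crit_lubs. c \<le> inf x x'}"
    if "{c\<in>crit_lubs. c \<le> x} = {c\<in>crit_lubs. c \<le> x'}" for x x'
    using that by auto
  have "inf u u' \<le> inf v v'" using assms(1,2) by (rule inf_mono)
  from homology_rank_shrink[OF this inf_le1 inf_le1 assms(1) inf(1)[OF crit(1)] inf(1)[OF crit(2)], where 'k = 'k]
    homology_rank_shrink[OF this inf_le2 inf_le2 assms(2) inf(2)[OF crit(1)] inf(2)[OF crit(2)], where 'k = 'k]
  show ?thesis by simp
qed

lemma line_mono: "strictly_below 0 m \<Longrightarrow> s \<le> t \<Longrightarrow> s *\<^sub>R m + u0 \<le> t *\<^sub>R m + u0"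
  by (auto simp: strictly_below_def less_eq_vec_def intro!: mult_right_mono less_imp_le)

lemma rank_fun_line:
  assumes "strictly_below 0 m" "s \<le> t"
  shows "rank_fun (restrict_to_line (pers_homology r F k :: (real ^ 'n, 'k::field, ('v set \<Rightarrow> 'k) set) pers_module) m u0) s t =
    int (homology_rank TYPE('k) r k (F (s *\<^sub>R m + u0)) (F (t *\<^sub>R m + u0)))"
  unfolding rank_fun_def restrict_to_line_def pers_homology_def homology_rank_def
  by (simp add: homology_image[OF complex_F complex_F F_mono[OF line_mono[OF assms]]])

lemma rank_fun_line_eq:
  assumes m: "strictly_below 0 m" "strictly_below 0 m'" and "s \<le> t" "s' \<le> t'"
    and crit: "{c\<in>crit_lubs. line_param m u0 c \<le> s} = {c\<in>crit_lubs. line_param m' u0' c \<le> s'}"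
      "{c\<in>crit_lubs. line_param m u0 c \<le> t} = {c\<in>crit_lubs. line_param m' u0' c \<le> t'}"
  shows "rank_fun (restrict_to_line (pers_homology r F k :: (real ^ 'n, 'k::field, ('v set \<Rightarrow> 'k) set) pers_module) m u0) s t =
    rank_fun (restrict_to_line (pers_homology r F k :: (real ^ 'n, 'k, ('v set \<Rightarrow> 'k) set) pers_module) m' u0') s' t'"
  using homology_rank_eq[OF line_mono[OF m(1) \<open>s \<le> t\<close>] line_mono[OF m(2) \<open>s' \<le> t'\<close>], of u0 u0', where 'k = 'k] crit
  by (simp add: rank_fun_line m \<open>s \<le> t\<close> \<open>s' \<le> t'\<close> le_line_iff)

text \<open>Nested complexes supply monotonicity and the rectangle inequality; constancy between
  jumps is \<open>rank_fun_line_eq\<close> for a line and itself.\<close>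

lemma finitely_stepped_line:
  assumes m: "strictly_below 0 m"
  shows "finitely_stepped (restrict_to_line (pers_homology r F k :: (real ^ 'n, 'k::field, ('v set \<Rightarrow> 'k) set) pers_module) m u0)
    crit_lubs (line_param m u0)"
proof
  note mono = F_mono[OF line_mono[OF m, where ?u0.0 = u0]]
  fix a b c d :: real assume "a \<le> b" "b \<le> c" "c \<le> d"
  then show "0 \<le> rect_rank (restrict_to_line (pers_homology r F k :: (real ^ 'n, 'k, ('v set \<Rightarrow> 'k) set) pers_module) m u0) a b c d"
    using homology_rank_rectangle[OF complex_F complex_F mono complex_F complex_F mono, of a b c d, where 'k = 'k and r = r and k = k]
    by (simp add: rect_rank_def rank_fun_line m)
next
  fix s s' t :: real assume "s \<le> s'" "s' \<le> t"
  then show "rank_fun (restrict_to_line (pers_homology r F k :: (real ^ 'n, 'k, ('v set \<Rightarrow> 'k) set) pers_module) m u0) s t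
    \<le> rank_fun (restrict_to_line (pers_homology r F k :: (real ^ 'n, 'k, ('v set \<Rightarrow> 'k) set) pers_module) m u0) s' t"
    using homology_rank_mono[OF complex_F complex_F F_mono[OF line_mono[OF m]], of s s', where 'k = 'k and r = r and k = k]
    by (simp add: rank_fun_line m)
qed (use finite_crit_lubs rank_fun_line_eq[OF m m] in blast)+

end

section \<open>The bijection between the two diagrams\<close>

theorem theorem3p17:
  fixes K :: "'v set set"
    and r :: "'v rel"
    and F :: "real ^ 'n \<Rightarrow> 'v set set"
    and V :: "('v set \<times> 'v set) set"
    and C Cbar :: "(real ^ 'n) set"
    and k :: int
    and W :: "(real ^ 'n, 'k::field, ('v set \<Rightarrow> 'k) set) pers_module"
    and m u0 m' u0' :: "real ^ 'n"
  assumes "finite_simplicial_complex K"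
    and "linear_order_on (\<Union>K) r"
    and "filtration K F"
    and "tame_one_critical K F"
    and "gradient_vector_field K V"
    and "consistent_with V F"
    and "C = entrance F ` critical_simplices K V"
    and "Cbar = lub_closure C"
    and "W = pers_homology r F k"
    and "0 \<prec> m" and "0 \<prec> m'"
    and "line_equiv Cbar (line m u0) (line m' u0')"
  shows "\<exists>\<gamma>. multi_bijection (dgm (restrict_to_line W m u0)) (dgm (restrict_to_line W m' u0')) \<gamma> \<and>
    (\<forall>s t s' t'. dgm (restrict_to_line W m u0) (s, t) > 0 \<and> \<gamma> (s, t) = (s', t') \<longrightarrow>
      {u \<in> Cbar. u \<le> s *\<^sub>R m + u0} \<noteq> {} \<and>
      s' *\<^sub>R m' + u0' = push (line m' u0') (lower_proj Cbar (s *\<^sub>R m + u0)) \<and>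
      (\<forall>b. t = ereal b \<longrightarrow>
        {u \<in> Cbar. u \<le> b *\<^sub>R m + u0} \<noteq> {} \<and>
        (\<exists>b'. t' = ereal b' \<and>
          b' *\<^sub>R m' + u0' = push (line m' u0') (lower_proj Cbar (b *\<^sub>R m + u0)))) \<and>
      (t = \<infinity> \<longrightarrow> t' = \<infinity>))"
proof -
  interpret consistent_filtration K r V F
    using assms by unfold_locales auto
  have Cbar: "Cbar = crit_lubs" using assms(7,8) by (simp add: crit_lubs_def)
  let ?p = "line_param m u0" and ?p' = "line_param m' u0'"
  let ?W = "restrict_to_line W m u0" and ?W' = "restrict_to_line W m' u0'"
  note m = \<open>0 \<prec> m\<close> \<open>0 \<prec> m'\<close>
  note equiv = assms(12)[unfolded Cbar]
  interpret L: finitely_stepped ?W crit_lubs ?p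
    unfolding assms(9) by (rule finitely_stepped_line[OF m(1)])
  interpret L': finitely_stepped ?W' crit_lubs ?p'
    unfolding assms(9) by (rule finitely_stepped_line[OF m(2)])
  \<comment> \<open>Equivalence of lines is symmetric, which yields the converse of the order
    comparison.\<close>
  have equiv': "line_equiv crit_lubs (line m' u0') (line m u0)"
    using equiv unfolding line_equiv_def by blast
  interpret order_equivalent_steps ?W ?W' crit_lubs ?p ?p'
  proof
    fix c d assume cd: "c \<in> crit_lubs" "d \<in> crit_lubs"
    note cd' = cd crit_lubs_sup[OF cd]
    show "?p c \<le> ?p d \<longleftrightarrow> ?p' c \<le> ?p' d"
      using line_equiv_order[OF m equiv cd'] line_equiv_order[OF m(2,1) equiv' cd'] by blast
  next
    fix s t s' t' :: real
    assume "s \<le> t" "s' \<le> t'" "{c\<in>crit_lubs. ?p c \<le> s} = {c\<in>crit_lubs. ?p' c \<le> s'}"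
      "{c\<in>crit_lubs. ?p c \<le> t} = {c\<in>crit_lubs. ?p' c \<le> t'}"
    then show "rank_fun ?W s t = rank_fun ?W' s' t'"
      unfolding assms(9) by (rule rank_fun_line_eq[OF m])
  qed
  define \<phi> where "\<phi> s = ?p' (lower_proj crit_lubs (s *\<^sub>R m + u0))" for s
  have proj: "lower_proj crit_lubs (?p c *\<^sub>R m + u0) \<in> crit_lubs" "c \<le> ?p c *\<^sub>R m + u0"
    if c: "c \<in> crit_lubs" for c
  proof -
    show "c \<le> ?p c *\<^sub>R m + u0" using le_line_iff[OF m(1)] by blast
    then show "lower_proj crit_lubs (?p c *\<^sub>R m + u0) \<in> crit_lubs"
      using lower_proj_greatest(1)[OF finite_crit_lubs crit_lubs_sup c] by blast
  qed
  \<comment> \<open>At a jump the projection and \<open>c\<close> have the same parameter on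
    \<open>L\<close>, so \<open>eq_iff\<close> equates their parameters on
    \<open>L'\<close>.\<close>
  have \<phi>: "\<phi> (?p c) = ?p' c" if c: "c \<in> crit_lubs" for c
    unfolding \<phi>_def using eq_iff[OF proj(1)[OF c] c]
      line_param_lower_proj[OF m(1) finite_crit_lubs crit_lubs_sup c] by blast
  have push: "\<phi> s *\<^sub>R m' + u0' = push (line m' u0') (lower_proj crit_lubs (s *\<^sub>R m + u0))" for s
    by (simp add: \<phi>_def push_line[OF m(2)])
  let ?\<gamma> = "\<lambda>(s, t). (\<phi> s, if t = \<infinity> then \<infinity> else ereal (\<phi> (real_of_ereal t)))"
  have nonempty: "{u\<in>crit_lubs. u \<le> ?p c *\<^sub>R m + u0} \<noteq> {}" if "c \<in> crit_lubs" for c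
    using proj(2) that by blast
  \<comment> \<open>Finite coordinates of a diagram point are jumps, where some member of
    \<open>crit_lubs\<close> lies below the point of \<open>L\<close>; so the projections are
    meaningful.\<close>
  have support: "{u\<in>crit_lubs. u \<le> s *\<^sub>R m + u0} \<noteq> {} \<and>
      (\<forall>b. t = ereal b \<longrightarrow> {u\<in>crit_lubs. u \<le> b *\<^sub>R m + u0} \<noteq> {})"
    if pos: "dgm ?W (s, t) > 0" for s t
  proof -
    obtain c where c: "c \<in> crit_lubs" "s = ?p c" and t: "t = \<infinity> \<or> (\<exists>d\<in>crit_lubs. t = ereal (?p d))"
      using L.dgm_support[OF pos] .
    have "{u\<in>crit_lubs. u \<le> b *\<^sub>R m + u0} \<noteq> {}" if "t = ereal b" for b
    proof -
      from t that obtain d where "d \<in> crit_lubs" "b = ?p d" by auto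
      then show ?thesis using nonempty by blast
    qed
    then show ?thesis using nonempty[OF c(1)] unfolding c(2) by blast
  qed
  show ?thesis
    unfolding Cbar
  proof (intro exI[of _ ?\<gamma>] conjI allI impI; (elim conjE)?)
    show "multi_bijection (dgm ?W) (dgm ?W') ?\<gamma>" by (rule dgm_multi_bijection[OF \<phi>])
  qed (use support push in auto)
qed

end
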